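(* Let $\Omega\subset\mathbb{R}^d$, $d\in\{2,3\}$, be a bounded domain with $C^{1,1}$ boundary and let $\gamma:[0,1]\to\partial\Omega$ be a $C^1$ curve on the boundary. Let $f\in L^\infty(\Omega)$ and $j\in W^{1,\infty}(\partial\Omega)$ satisfy $\int_\Omega f\,dx+\int_{\partial\Omega} j\,ds(x)=0$. Let $a,\tilde a\in\mathcal{A}_{ad}$, and let $u,\tilde u$ denote solutions of $$-\operatorname{div}(a(u)\nabla u)=f \ \text{ in }\Omega,\qquad a(u)\,\partial_n u=j\ \text{ on }\partial\Omega,$$ and $$-\operatorname{div}(\tilde a(\tilde u)\nabla \tilde u)=f \ \text{ in }\Omega,\qquad \tilde a(\tilde u)\,\partial_n \tilde u=j\ \text{ on }\partial\Omega,$$ respectively (identical data $f,j$). If $u|_\gamma=g=\tilde u|_\gamma$ on $\gamma$, then $a(s)=\tilde a(s)$ for all $s\in\operatorname{int}\{g(\gamma(r)) : r\in[0,1]\}$.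
   Context: The constants $0<\underline a\le\overline a$ and $C_1$ are fixed, and the set of admissible parameters is $$\mathcal{A}_{ad}=\{q\in W^{1,\infty}(\mathbb{R}) : 0<\underline a\le q(s)\le\overline a \text{ and } |q'(s)|\le C_1 \text{ for } s\in\mathbb{R}\}.$$ Solutions $u,\tilde u$ are understood in $W^{2,p}(\Omega)$ for all $p<\infty$; in particular they are continuous up to the boundary, so that the restrictions $u|_\gamma,\tilde u|_\gamma$ to (the image of) $\gamma$ are well defined. $\partial_n$ is the outward normal derivative on $\partial\Omega$, and $\operatorname{int}$ denotes the interior of a subset of $\mathbb{R}$. *)

theory Defs
  imports "HOL-Analysis.Analysis"
begin

section \<open>Lebesgue and Sobolev spaces on open sets\<close>

definition locally_integrable_on ::
    "'a::euclidean_space set \<Rightarrow> ('a \<Rightarrow> 'b::euclidean_space) \<Rightarrow> bool" where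
  "locally_integrable_on \<Omega> F \<longleftrightarrow>
     (\<forall>K. compact K \<and> K \<subseteq> \<Omega> \<longrightarrow> set_integrable lebesgue K F)"

text \<open>The exponent ranges over \<open>[1, \<infinity>]\<close>, with \<open>p = \<infinity>\<close> meaning essentially bounded.\<close>

definition in_Lp ::
    "'a::euclidean_space set \<Rightarrow> ennreal \<Rightarrow> ('a \<Rightarrow> real) \<Rightarrow> bool" where
  "in_Lp \<Omega> p u \<longleftrightarrow>
     set_borel_measurable lebesgue \<Omega> u \<and>
     (if p = \<infinity>
      then \<exists>C. AE x in lebesgue. x \<in> \<Omega> \<longrightarrow> \<bar>u x\<bar> \<le> C
      else set_integrable lebesgue \<Omega> (\<lambda>x. \<bar>u x\<bar> powr enn2real p))"

primrec Ck :: "nat \<Rightarrow> ('a::euclidean_space \<Rightarrow> real) \<Rightarrow> bool" where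
  "Ck 0 \<phi> \<longleftrightarrow> continuous_on UNIV \<phi>"
| "Ck (Suc k) \<phi> \<longleftrightarrow>
     (\<forall>x. \<phi> differentiable (at x)) \<and>
     (\<forall>b\<in>Basis. Ck k (\<lambda>x. frechet_derivative \<phi> (at x) b))"

text \<open>\<open>C\<^sub>c\<^sup>\<infinity>(\<Omega>)\<close>, its elements being extended by zero to the whole space.\<close>

definition test_function :: "'a::euclidean_space set \<Rightarrow> ('a \<Rightarrow> real) \<Rightarrow> bool" where
  "test_function \<Omega> \<phi> \<longleftrightarrow>
     (\<forall>k. Ck k \<phi>) \<and> compact (closure {x. \<phi> x \<noteq> 0}) \<and> closure {x. \<phi> x \<noteq> 0} \<subseteq> \<Omega>"

definition has_weak_partial_derivative ::
    "'a::euclidean_space set \<Rightarrow> 'a \<Rightarrow> ('a \<Rightarrow> real) \<Rightarrow> ('a \<Rightarrow> real) \<Rightarrow> bool" where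
  "has_weak_partial_derivative \<Omega> b u v \<longleftrightarrow>
     locally_integrable_on \<Omega> u \<and> locally_integrable_on \<Omega> v \<and>
     (\<forall>\<phi>. test_function \<Omega> \<phi> \<longrightarrow>
        (LINT x:\<Omega>|lebesgue. u x * frechet_derivative \<phi> (at x) b) =
        - (LINT x:\<Omega>|lebesgue. v x * \<phi> x))"

definition has_weak_gradient ::
    "'a::euclidean_space set \<Rightarrow> ('a \<Rightarrow> real) \<Rightarrow> ('a \<Rightarrow> 'a) \<Rightarrow> bool" where
  "has_weak_gradient \<Omega> u G \<longleftrightarrow>
     (\<forall>b\<in>Basis. has_weak_partial_derivative \<Omega> b u (\<lambda>x. G x \<bullet> b))"

text \<open>In the next definition, \<open>frechet_derivative \<phi> (at x) (F x)\<close> is \<open>F x \<bullet> \<nabla>\<phi> x\<close>.\<close>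

definition has_weak_divergence ::
    "'a::euclidean_space set \<Rightarrow> ('a \<Rightarrow> 'a) \<Rightarrow> ('a \<Rightarrow> real) \<Rightarrow> bool" where
  "has_weak_divergence \<Omega> F v \<longleftrightarrow>
     locally_integrable_on \<Omega> F \<and> locally_integrable_on \<Omega> v \<and>
     (\<forall>\<phi>. test_function \<Omega> \<phi> \<longrightarrow>
        (LINT x:\<Omega>|lebesgue. frechet_derivative \<phi> (at x) (F x)) =
        - (LINT x:\<Omega>|lebesgue. v x * \<phi> x))"

text \<open>\<open>in_sobolev k p \<Omega>\<close> is \<open>W\<^sup>k\<^sup>,\<^sup>p(\<Omega>)\<close>.\<close>

primrec in_sobolev ::
    "nat \<Rightarrow> ennreal \<Rightarrow> 'a::euclidean_space set \<Rightarrow> ('a \<Rightarrow> real) \<Rightarrow> bool" where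
  "in_sobolev 0 p \<Omega> u \<longleftrightarrow> in_Lp \<Omega> p u"
| "in_sobolev (Suc k) p \<Omega> u \<longleftrightarrow>
     in_Lp \<Omega> p u \<and>
     (\<forall>b\<in>Basis. \<exists>v. has_weak_partial_derivative \<Omega> b u v \<and> in_sobolev k p \<Omega> v)"

section \<open>Domains with \<open>C\<^sup>1\<^sup>,\<^sup>1\<close> boundary\<close>

definition C11 :: "('a::euclidean_space \<Rightarrow> real) \<Rightarrow> bool" where
  "C11 h \<longleftrightarrow> (\<exists>G L. (\<forall>x. GDERIV h x :> G x) \<and> L-lipschitz_on UNIV G)"

definition hyperplane_proj :: "'a::euclidean_space \<Rightarrow> 'a \<Rightarrow> 'a" where
  "hyperplane_proj e y = y - (y \<bullet> e) *\<^sub>R e"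

text \<open>
  Near \<open>x0\<close> the set \<open>\<Omega>\<close> is the part below the graph of \<open>h\<close> in the direction of the unit
  vector \<open>e\<close>. Only the values of \<open>h\<close> on the hyperplane orthogonal to \<open>e\<close> matter.
\<close>

definition boundary_chart ::
    "'a::euclidean_space set \<Rightarrow> 'a \<Rightarrow> 'a \<Rightarrow> real \<Rightarrow> ('a \<Rightarrow> real) \<Rightarrow> bool" where
  "boundary_chart \<Omega> x0 e r h \<longleftrightarrow>
     norm e = 1 \<and> r > 0 \<and> C11 h \<and>
     \<Omega> \<inter> ball x0 r = {y \<in> ball x0 r. y \<bullet> e < h (hyperplane_proj e y)}"

definition C11_boundary :: "'a::euclidean_space set \<Rightarrow> bool" where
  "C11_boundary \<Omega> \<longleftrightarrow> (\<forall>x0 \<in> frontier \<Omega>. \<exists>e r h. boundary_chart \<Omega> x0 e r h)"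

definition bounded_domain :: "'a::euclidean_space set \<Rightarrow> bool" where
  "bounded_domain \<Omega> \<longleftrightarrow> open \<Omega> \<and> connected \<Omega> \<and> \<Omega> \<noteq> {} \<and> bounded \<Omega>"

text \<open>
  The outward unit normal is the normalized gradient of the local defining function of \<open>\<Omega>\<close>
  (negative inside, positive outside). It does not depend on the chart.
\<close>

definition outward_normal :: "'a::euclidean_space set \<Rightarrow> 'a \<Rightarrow> 'a" where
  "outward_normal \<Omega> x =
     (SOME \<nu>. \<exists>e r h D. boundary_chart \<Omega> x e r h \<and>
        (GDERIV (\<lambda>y. y \<bullet> e - h (hyperplane_proj e y)) x :> D) \<and> \<nu> = sgn D)"

text \<open>
  The derivative is one-sided, from within \<open>\<Omega>\<close>: for small \<open>t > 0\<close> the point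
  \<open>x - t \<nu>\<close> lies in \<open>\<Omega>\<close>. For functions that are \<open>C\<^sup>1\<close> up to the boundary, it is the
  trace of the gradient multiplied by the normal.
\<close>

definition has_outward_normal_derivative ::
    "'a::euclidean_space set \<Rightarrow> ('a \<Rightarrow> real) \<Rightarrow> 'a \<Rightarrow> real \<Rightarrow> bool" where
  "has_outward_normal_derivative \<Omega> u x D \<longleftrightarrow>
     ((\<lambda>t. (u x - u (x - t *\<^sub>R outward_normal \<Omega> x)) / t) \<longlongrightarrow> D) (at_right 0)"

section \<open>Functions and integrals on the boundary\<close>

text \<open>
  Hausdorff measure of dimension \<open>m \<ge> 1\<close>, normalized so that it agrees with
  \<open>m\<close>-dimensional area. The bound on diameters is stated together with boundedness because
  \<^const>\<open>diameter\<close> is unspecified on unbounded sets. The case \<open>m = 0\<close> is not intended: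
  empty members of a cover would then contribute \<open>0 ^ 0 = 1\<close>.
\<close>

definition hausdorff_outer :: "nat \<Rightarrow> 'a::euclidean_space set \<Rightarrow> ennreal" where
  "hausdorff_outer m E =
     (SUP \<delta>\<in>{0<..}.
        INF C\<in>{C :: nat \<Rightarrow> 'a set. E \<subseteq> (\<Union>i. C i) \<and> (\<forall>i. bounded (C i) \<and> diameter (C i) \<le> \<delta>)}.
          (\<Sum>i. ennreal (unit_ball_vol (real m) * (diameter (C i) / 2) ^ m)))"

definition hausdorff_measure :: "nat \<Rightarrow> 'a::euclidean_space measure" where
  "hausdorff_measure m = measure_of UNIV (sets borel) (hausdorff_outer m)"

definition surface_integral ::
    "'a::euclidean_space set \<Rightarrow> ('a \<Rightarrow> real) \<Rightarrow> real" where
  "surface_integral S j = (LINT x:S|hausdorff_measure (DIM('a) - 1). j x)"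

text \<open>
  \<open>W\<^sup>1\<^sup>,\<^sup>\<infinity>(\<partial>\<Omega>)\<close>, each element being given by its continuous representative: in every chart
  the function, written in the parameters of the chart, is in \<open>W\<^sup>1\<^sup>,\<^sup>\<infinity>\<close>. Since the hyperplane
  of parameters is not a type, the pullback is extended constantly in the direction \<open>e\<close> to a
  cylinder over the parameter domain; this does not affect membership in \<open>W\<^sup>1\<^sup>,\<^sup>\<infinity>\<close>.
\<close>

definition in_W1inf_boundary ::
    "'a::euclidean_space set \<Rightarrow> ('a \<Rightarrow> real) \<Rightarrow> bool" where
  "in_W1inf_boundary \<Omega> j \<longleftrightarrow>
     continuous_on (frontier \<Omega>) j \<and>
     (\<forall>x0 \<in> frontier \<Omega>. \<forall>e r h. boundary_chart \<Omega> x0 e r h \<longrightarrow>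
        (let \<Phi> = (\<lambda>y. hyperplane_proj e y + h (hyperplane_proj e y) *\<^sub>R e)
         in in_sobolev 1 \<infinity> {y. \<Phi> y \<in> ball x0 r} (\<lambda>y. j (\<Phi> y))))"

definition C1_curve :: "(real \<Rightarrow> 'a::euclidean_space) \<Rightarrow> bool" where
  "C1_curve \<gamma> \<longleftrightarrow>
     (\<exists>\<gamma>'. continuous_on {0..1} \<gamma>' \<and>
        (\<forall>t\<in>{0..1}. (\<gamma> has_vector_derivative \<gamma>' t) (at t within {0..1})))"

section \<open>The quasilinear Neumann problem\<close>

text \<open>Parameters are given by their continuous representative, so that the bounds
  \<open>lo \<le> q s \<le> hi\<close> hold everywhere. The bound on the derivative holds almost everywhere.\<close>

definition admissible :: "real \<Rightarrow> real \<Rightarrow> real \<Rightarrow> (real \<Rightarrow> real) set" where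
  "admissible lo hi C1 =
     {q. in_sobolev 1 \<infinity> UNIV q \<and> continuous_on UNIV q \<and>
         (\<forall>s. 0 < lo \<and> lo \<le> q s \<and> q s \<le> hi) \<and>
         (\<exists>q'. has_weak_partial_derivative UNIV 1 q q' \<and> (AE s in lebesgue. \<bar>q' s\<bar> \<le> C1))}"

text \<open>
  \<open>u\<close> is in \<open>W\<^sup>2\<^sup>,\<^sup>p(\<Omega>)\<close> for all \<open>p < \<infinity>\<close> and is given by its representative that is
  continuous up to the boundary. Since \<open>a(u)\<nabla>u\<close> is then in \<open>W\<^sup>1\<^sup>,\<^sup>p(\<Omega>)\<close>, the weak divergence in
  the equation is a function, determined almost everywhere. By the embedding into
  \<open>C\<^sup>1\<close> up to the boundary and the continuity of \<open>j\<close>, the boundary condition holds at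
  every boundary point.
\<close>

definition neumann_solution ::
    "'a::euclidean_space set \<Rightarrow> (real \<Rightarrow> real) \<Rightarrow> ('a \<Rightarrow> real) \<Rightarrow> ('a \<Rightarrow> real) \<Rightarrow> ('a \<Rightarrow> real) \<Rightarrow> bool"
  where
  "neumann_solution \<Omega> a f j u \<longleftrightarrow>
     continuous_on (closure \<Omega>) u \<and>
     (\<forall>p. 1 \<le> p \<and> p < \<infinity> \<longrightarrow> in_sobolev 2 p \<Omega> u) \<and>
     (\<exists>G. has_weak_gradient \<Omega> u G \<and>
        has_weak_divergence \<Omega> (\<lambda>x. a (u x) *\<^sub>R G x) (\<lambda>x. - f x)) \<and>
     (\<forall>x \<in> frontier \<Omega>. \<exists>D. has_outward_normal_derivative \<Omega> u x D \<and> a (u x) * D = j x)"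

end

theory Submission
  imports Defs
begin

text \<open>
  Let \<open>A\<close> and \<open>A'\<close> be antiderivatives of \<open>a\<close> and \<open>a'\<close>. By the chain rule, \<open>W = A(u) - A'(u')\<close>
  is weakly harmonic in \<open>\<Omega>\<close>, and its normal derivative vanishes on the whole boundary. It is
  continuous up to the boundary, so it attains its maximum; at a boundary maximum the Hopf lemma
  would give a nonzero normal derivative, so the maximum is attained inside and \<open>W\<close> is constant.
  Hence \<open>A - A'\<close> is constant on the set of values of \<open>u\<close> along the curve, and differentiating
  gives \<open>a = a'\<close> in its interior.

  No regularity theory is needed. Weak harmonicity only enters through the mollifications of \<open>W\<close>,
  whose second difference quotients have vanishing limits; together with a strictly subharmonic
  barrier this suffices for the weak maximum principle, the strong one, and the Hopf lemma.
\<close>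

section \<open>Smooth functions and mollifiers\<close>

text \<open>Passing from \<open>u\<close> to \<open>A (u)\<close> is the Kirchhoff transformation:
  it turns both quasilinear problems into Poisson equations with the same right-hand side and the
  same Neumann data, which cancel in the difference. The obstacle is that it is applied to functions
  known to be continuous and weakly differentiable, so neither the chain rule nor the second
  derivative test at a maximum is available pointwise. Mollification recovers both. At an interior
  maximum, symmetric second differences are nonpositive, and difference quotients of a convolution
  fall on the smooth kernel; hence second differences rather than a pointwise Laplacian carry the
  comparison argument. The barrier has to be strictly subharmonic because the mollified harmonic
  part contributes exactly zero in the limit. Near the boundary the comparison still takes place on
  compact subsets of \<open>\<Omega>\<close>, and the C^{1,1} regularity enters through an interior
  tangent ball. Convolutions integrate over the whole space, so \<open>u\<close> and
  \<open>u'\<close> are first replaced by bounded continuous extensions.\<close>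

abbreviation partial :: "'a::euclidean_space \<Rightarrow> ('a \<Rightarrow> real) \<Rightarrow> 'a \<Rightarrow> real" where
  "partial b \<phi> \<equiv> \<lambda>x. frechet_derivative \<phi> (at x) b"

definition laplacian :: "('a::euclidean_space \<Rightarrow> real) \<Rightarrow> 'a \<Rightarrow> real" where
  "laplacian \<phi> x = (\<Sum>b\<in>Basis. partial b (partial b \<phi>) x)"

lemma partial_eqI: "(\<phi> has_derivative D) (at x) \<Longrightarrow> partial b \<phi> x = D b"
  by (metis frechet_derivative_at)

lemma Ck_continuous: "Ck k \<phi> \<Longrightarrow> continuous_on UNIV \<phi>"
  by (cases k) (auto simp: continuous_on_eq_continuous_at differentiable_imp_continuous_within)

lemma Ck_Suc_imp: "Ck (Suc k) \<phi> \<Longrightarrow> Ck k \<phi>"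
proof (induction k arbitrary: \<phi>)
  case 0 then show ?case using Ck_continuous by (metis Ck.simps(1))
next
  case (Suc k)
  then show ?case by (metis Ck.simps(2))
qed

lemma Ck_const: "Ck k (\<lambda>x. c)"
  by (induction k arbitrary: c) auto

lemma Ck_inner: "Ck k (\<lambda>x. x \<bullet> b)"
proof (cases k)
  case (Suc m)
  have "((\<lambda>x. x \<bullet> b) has_derivative (\<lambda>x. x \<bullet> b)) (at x)" for x
    by (auto intro!: derivative_eq_intros)
  then have "partial i (\<lambda>x. x \<bullet> b) = (\<lambda>x. i \<bullet> b)" and "(\<lambda>x. x \<bullet> b) differentiable (at x)" for i x
    by (auto intro!: ext partial_eqI differentiableI)
  then show ?thesis using Suc by (simp add: Ck_const)
qed (auto intro!: continuous_intros)

lemma Ck_add: "Ck k f \<Longrightarrow> Ck k g \<Longrightarrow> Ck k (\<lambda>x. f x + g x)"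
proof (induction k arbitrary: f g)
  case (Suc k)
  have "((\<lambda>x. f x + g x) has_derivative
      (\<lambda>h. frechet_derivative f (at x) h + frechet_derivative g (at x) h)) (at x)" for x
    using Suc.prems by (auto intro!: has_derivative_add simp: frechet_derivative_works[symmetric])
  then have "partial b (\<lambda>x. f x + g x) = (\<lambda>x. partial b f x + partial b g x)"
    and "(\<lambda>x. f x + g x) differentiable (at x)" for b x
    by (auto intro!: ext partial_eqI differentiableI)
  then show ?case using Suc by simp
qed (auto intro!: continuous_intros)

lemma Ck_mult: "Ck k f \<Longrightarrow> Ck k g \<Longrightarrow> Ck k (\<lambda>x. f x * g x)"
proof (induction k arbitrary: f g)
  case (Suc k)
  have "((\<lambda>x. f x * g x) has_derivative
      (\<lambda>h. f x * frechet_derivative g (at x) h + frechet_derivative f (at x) h * g x)) (at x)" for x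
    using Suc.prems by (auto intro!: has_derivative_mult simp: frechet_derivative_works[symmetric])
  then have "partial b (\<lambda>x. f x * g x) = (\<lambda>x. f x * partial b g x + partial b f x * g x)"
    and "(\<lambda>x. f x * g x) differentiable (at x)" for b x
    by (auto intro!: ext partial_eqI differentiableI)
  then show ?case using Suc Ck_Suc_imp[of k f] Ck_Suc_imp[of k g] by (auto intro!: Ck_add)
qed (auto intro!: continuous_intros)

lemma partial_reflect:
  assumes "\<forall>x. \<phi> differentiable (at x)"
  shows "partial b (\<lambda>y. \<phi> (x - y)) y = - partial b \<phi> (x - y)"
    and "(\<lambda>y. \<phi> (x - y)) differentiable (at y)"
proof -
  have "((\<lambda>y. x - y) has_derivative (\<lambda>h. - h)) (at y)"
    by (auto intro!: derivative_eq_intros)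
  moreover have "(\<phi> has_derivative frechet_derivative \<phi> (at (x - y))) (at (x - y))"
    using assms frechet_derivative_works by blast
  ultimately have D: "((\<lambda>y. \<phi> (x - y)) has_derivative
      (\<lambda>h. frechet_derivative \<phi> (at (x - y)) (- h))) (at y)"
    by (rule has_derivative_compose)
  show "partial b (\<lambda>y. \<phi> (x - y)) y = - partial b \<phi> (x - y)"
    using partial_eqI[OF D, of b] linear_frechet_derivative[of \<phi> "at (x - y)"] assms
    by (simp add: linear_neg)
  show "(\<lambda>y. \<phi> (x - y)) differentiable (at y)"
    using D by (rule differentiableI)
qed

lemma Ck_reflect: "Ck k \<phi> \<Longrightarrow> Ck k (\<lambda>y. \<phi> (x - y))"
proof (induction k arbitrary: \<phi>)
  case 0
  then show ?case
    by (auto intro!: continuous_on_compose2[of UNIV \<phi>] continuous_intros)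
next
  case (Suc k)
  then have "Ck k (\<lambda>y. (-1) * partial b \<phi> (x - y))" if "b \<in> Basis" for b
    using that by (intro Ck_mult Ck_const) auto
  with Suc.prems show ?case by (auto simp: partial_reflect)
qed

text \<open>Each derivative of the reflected function brings a minus sign, and two of them cancel.
  This identifies the Laplacian of the test function \<open>\<eta> (x - y)\<close> in
  \<open>y\<close> with the kernel that appears when \<open>convolve\<close> is differentiated in
  \<open>x\<close>.\<close>

lemma laplacian_reflect:
  assumes "Ck 2 \<phi>"
  shows "laplacian (\<lambda>y. \<phi> (x - y)) y = laplacian \<phi> (x - y)"
proof -
  have "partial b (partial b (\<lambda>y. \<phi> (x - y))) y = partial b (partial b \<phi>) (x - y)" if "b \<in> Basis" for b
  proof -
    have d: "\<forall>x. partial b \<phi> differentiable (at x)" "\<forall>x. \<phi> differentiable (at x)"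
      using assms that by (auto simp: numeral_2_eq_2)
    have "((\<lambda>y. - partial b \<phi> (x - y)) has_derivative
        (\<lambda>h. - frechet_derivative (\<lambda>y. partial b \<phi> (x - y)) (at y) h)) (at y)"
      using partial_reflect(2)[OF d(1), of x y]
      by (intro has_derivative_minus) (simp only: frechet_derivative_works)
    then have "partial b (\<lambda>y. - partial b \<phi> (x - y)) y = - partial b (\<lambda>y. partial b \<phi> (x - y)) y"
      by (rule partial_eqI)
    then show ?thesis
      unfolding partial_reflect(1)[OF d(2)] partial_reflect(1)[OF d(1)] by simp
  qed
  then show ?thesis unfolding laplacian_def by simp
qed

lemma partial_along:
  assumes "\<forall>x. \<phi> differentiable (at x)"
  shows "((\<lambda>t. \<phi> (x + t *\<^sub>R b)) has_real_derivative partial b \<phi> (x + s *\<^sub>R b)) (at s)"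
proof -
  have "((\<lambda>t. x + t *\<^sub>R b) has_derivative (\<lambda>t. t *\<^sub>R b)) (at s)"
    by (auto intro!: derivative_eq_intros)
  moreover have D: "(\<phi> has_derivative frechet_derivative \<phi> (at (x + s *\<^sub>R b))) (at (x + s *\<^sub>R b))"
    using assms frechet_derivative_works by blast
  ultimately have "((\<lambda>t. \<phi> (x + t *\<^sub>R b)) has_derivative
      (\<lambda>t. frechet_derivative \<phi> (at (x + s *\<^sub>R b)) (t *\<^sub>R b))) (at s)"
    by (rule has_derivative_compose)
  moreover have "frechet_derivative \<phi> (at (x + s *\<^sub>R b)) (t *\<^sub>R b) = partial b \<phi> (x + s *\<^sub>R b) * t" for t
    using linear_frechet_derivative[of \<phi> "at (x + s *\<^sub>R b)"] assms by (simp add: linear_cmul)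
  ultimately show ?thesis by (simp add: has_field_derivative_def)
qed

section \<open>Construction of smooth even kernels of integral one\<close>

text \<open>For \<open>p = 1\<close> this is the standard smooth function that is flat at \<open>0\<close>; allowing a
  polynomial factor makes the family closed under differentiation.\<close>

definition flat_exp :: "real poly \<Rightarrow> real \<Rightarrow> real" where
  "flat_exp p t = (if t > 0 then poly p (1 / t) * exp (- (1 / t)) else 0)"

lemma poly_times_exp_minus_tendsto_0: "((\<lambda>x. poly p x * exp (- x)) \<longlongrightarrow> 0) at_top" for p :: "real poly"
proof -
  have "((\<lambda>x. \<Sum>i\<le>degree p. coeff p i * (x ^ i / exp x)) \<longlongrightarrow> (\<Sum>i\<le>degree p. coeff p i * 0)) at_top"
    by (intro tendsto_intros tendsto_power_div_exp_0)
  then show ?thesis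
    by (simp add: poly_altdef exp_minus sum_distrib_right divide_inverse mult.assoc)
qed

lemma flat_exp_tendsto_0: "(flat_exp p \<longlongrightarrow> 0) (at 0)"
proof -
  have "((\<lambda>t. poly p (inverse t) * exp (- inverse t)) \<longlongrightarrow> 0) (at_right 0)"
    using filterlim_compose[OF poly_times_exp_minus_tendsto_0 filterlim_inverse_at_top_right] .
  then have "(flat_exp p \<longlongrightarrow> 0) (at_right 0)"
    by (rule Lim_transform_eventually)
       (auto simp: flat_exp_def eventually_at_filter divide_inverse)
  moreover have "(flat_exp p \<longlongrightarrow> 0) (at_left 0)"
    by (rule Lim_transform_eventually[OF tendsto_const])
       (auto simp: flat_exp_def eventually_at_filter)
  ultimately show ?thesis by (simp add: filterlim_split_at)
qed

lemma flat_exp_has_derivative: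
  "(flat_exp p has_real_derivative flat_exp (monom 1 2 * (p - pderiv p)) t) (at t)"
proof -
  consider "t > 0" | "t < 0" | "t = 0" by linarith
  then show ?thesis
  proof cases
    case 1
    have "((\<lambda>t. poly p (1 / t) * exp (- (1 / t))) has_real_derivative
        flat_exp (monom 1 2 * (p - pderiv p)) t) (at t)"
      using 1 by (auto intro!: derivative_eq_intros DERIV_chain2[OF poly_DERIV]
          simp: flat_exp_def poly_monom field_simps power2_eq_square)
    moreover have "\<forall>\<^sub>F s in nhds t. poly p (1 / s) * exp (- (1 / s)) = flat_exp p s"
      using 1 by (intro eventually_mono[OF eventually_nhds_in_open[of "{0<..}" t]]) (auto simp: flat_exp_def)
    ultimately show ?thesis
      by (metis (no_types) DERIV_cong_ev[THEN iffD1, OF refl _ refl])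
  next
    case 2
    have "\<forall>\<^sub>F s in nhds t. flat_exp p s = 0"
      using 2 by (intro eventually_mono[OF eventually_nhds_in_open[of "{..<0}" t]]) (auto simp: flat_exp_def)
    from DERIV_cong_ev[OF refl this refl, of 0] have "(flat_exp p has_real_derivative 0) (at t)"
      by simp
    then show ?thesis using 2 by (simp add: flat_exp_def)
  next
    \<comment> \<open>At the origin the difference quotient is again a member of the family:
      dividing by \<open>h\<close> multiplies \<open>p\<close> by the indeterminate, so its limit is
      already known. At \<open>h = 0\<close> both sides are 0, by the convention for division by
      zero.\<close>
    case 3
    have "(flat_exp p h - 0) / h = flat_exp (monom 1 1 * p) h" for h
      by (auto simp: flat_exp_def poly_monom)
    moreover have "flat_exp q 0 = 0" for q by (simp add: flat_exp_def)
    ultimately show ?thesis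
      unfolding DERIV_def using flat_exp_tendsto_0[of "monom 1 1 * p"] 3 by simp
  qed
qed

text \<open>The induction runs over all \<open>p\<close> at once: one derivative yields another
  \<open>flat_exp\<close> composite times a partial derivative of \<open>h\<close>, and
  \<open>Ck\<close> is closed under products.\<close>

lemma Ck_flat_exp_compose:
  assumes "\<And>k. Ck k h"
  shows "Ck k (\<lambda>x. flat_exp p (h x))"
proof (induction k arbitrary: p)
  case 0
  have "continuous_on UNIV (flat_exp p)"
    by (metis DERIV_isCont continuous_at_imp_continuous_on flat_exp_has_derivative)
  then show ?case using assms[of 0] continuous_on_compose2[of UNIV "flat_exp p" UNIV h] by auto
next
  case (Suc k)
  let ?q = "monom 1 2 * (p - pderiv p)"
  have "(h has_derivative frechet_derivative h (at x)) (at x)" for x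
    using assms[of "Suc 0"] by (simp add: frechet_derivative_works[symmetric])
  from has_derivative_compose[OF this flat_exp_has_derivative[unfolded has_field_derivative_def]]
  have D: "((\<lambda>x. flat_exp p (h x)) has_derivative
      (\<lambda>v. flat_exp ?q (h x) * frechet_derivative h (at x) v)) (at x)" for x by simp
  have "Ck k (\<lambda>x. flat_exp ?q (h x) * partial b h x)" if "b \<in> Basis" for b
    using assms[of "Suc k"] that by (intro Ck_mult Suc.IH) auto
  moreover have "partial b (\<lambda>x. flat_exp p (h x)) = (\<lambda>x. flat_exp ?q (h x) * partial b h x)" for b
    using D by (intro ext partial_eqI)
  ultimately show ?case using D by (auto intro: differentiableI)
qed

lemma Ck_ball_function: "Ck k (\<lambda>x. c - x \<bullet> x)"
proof (cases k)
  case (Suc m)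
  have D: "((\<lambda>x. c - x \<bullet> x) has_derivative (\<lambda>h. (-2) * (x \<bullet> h))) (at x)" for x :: 'a
    by (auto intro!: derivative_eq_intros simp: inner_commute)
  have "partial b (\<lambda>x. c - x \<bullet> x) = (\<lambda>x. (-2) * (x \<bullet> b))" for b :: 'a
    using D by (intro ext partial_eqI)
  moreover have "Ck m (\<lambda>x. (-2) * (x \<bullet> b))" for b :: 'a
    by (intro Ck_mult Ck_const Ck_inner)
  ultimately show ?thesis using Suc D by (auto intro: differentiableI)
qed (auto intro!: continuous_intros)

text \<open>Evenness makes integration against \<open>\<eta> (x - y)\<close> an average around the
  fixed variable whichever of the two is integrated out. It is needed because Fubini moves the
  kernel from one factor to the other.\<close>

definition mollifier :: "real \<Rightarrow> ('a::euclidean_space \<Rightarrow> real) \<Rightarrow> bool" where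
  "mollifier \<delta> \<eta> \<longleftrightarrow> (\<forall>k. Ck k \<eta>) \<and> (\<forall>x. 0 \<le> \<eta> x) \<and> (\<forall>x. \<eta> (- x) = \<eta> x) \<and>
     (\<forall>x. \<delta> \<le> norm x \<longrightarrow> \<eta> x = 0) \<and> (LINT x|lborel. \<eta> x) = 1"

lemma integrable_continuous_bounded_support:
  fixes f :: "'a::euclidean_space \<Rightarrow> real"
  assumes "continuous_on UNIV f" "\<And>x. norm x \<ge> R \<Longrightarrow> f x = 0"
  shows "integrable lborel f"
proof -
  have "integrable lborel (\<lambda>x. indicator (cball 0 R) x *\<^sub>R f x)"
    by (intro borel_integrable_compact) (auto intro: continuous_on_subset[OF assms(1)])
  also have "(\<lambda>x. indicator (cball 0 R) x *\<^sub>R f x) = f"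
    using assms(2) by (auto simp: indicator_def fun_eq_iff)
  finally show ?thesis .
qed

lemma bounded_continuous_bounded_support:
  fixes f :: "'a::euclidean_space \<Rightarrow> real"
  assumes "continuous_on UNIV f" "\<And>x. norm x \<ge> R \<Longrightarrow> f x = 0"
  obtains B where "B > 0" "\<And>x. \<bar>f x\<bar> \<le> B"
proof -
  have "compact (f ` cball 0 R)"
    by (intro compact_continuous_image continuous_on_subset[OF assms(1)]) auto
  then obtain B where "B > 0" "\<And>x. x \<in> cball 0 R \<Longrightarrow> \<bar>f x\<bar> \<le> B"
    using compact_imp_bounded[of "f ` cball 0 R"] by (auto simp: bounded_pos)
  moreover then have "\<bar>f x\<bar> \<le> B" for x using assms(2)[of x] by (cases "norm x \<le> R") auto
  ultimately show ?thesis using that by blast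
qed

lemma mollifier_exists:
  assumes "\<delta> > 0"
  obtains \<eta> :: "'a::euclidean_space \<Rightarrow> real" where "mollifier \<delta> \<eta>"
proof -
  define F :: "'a \<Rightarrow> real" where "F x = flat_exp 1 (\<delta>\<^sup>2 - x \<bullet> x)" for x
  have F: "Ck k F" for k
    unfolding F_def by (intro Ck_flat_exp_compose Ck_ball_function)
  have F_nonneg: "0 \<le> F x" for x by (auto simp: F_def flat_exp_def)
  have F_zero: "F x = 0" if "\<delta> \<le> norm x" for x
    using power_mono[OF that, of 2] assms by (simp add: F_def flat_exp_def power2_norm_eq_inner)
  have int: "integrable lborel F"
    using integrable_continuous_bounded_support[OF Ck_continuous[OF F] F_zero] .
  define I where "I = (LINT x|lborel. F x)"
  \<comment> \<open>Normalization needs a nonzero integral: if it vanished, the nonnegative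
    \<open>F\<close> would be zero almost everywhere, although it is positive on an open
    ball.\<close>
  have "I \<noteq> 0"
  proof
    assume "I = 0"
    then have "AE x in lborel. F x = 0"
      unfolding I_def using integral_nonneg_eq_0_iff_AE[OF int] F_nonneg by auto
    have nz: "F x \<noteq> 0" if "x \<in> ball 0 \<delta>" for x
      using that power_strict_mono[of "norm x" \<delta> 2] by (simp add: F_def flat_exp_def power2_norm_eq_inner)
    from \<open>AE x in lborel. F x = 0\<close> have "AE x in lborel. x \<notin> ball (0::'a) \<delta>" by (rule eventually_mono) (use nz in blast)
    then have "ball (0::'a) \<delta> \<in> null_sets lborel"
      by (simp add: AE_iff_null_sets del: mem_ball)
    then show False
      using open_not_negligible[of "ball (0::'a) \<delta>"] assms
      by (simp add: negligible_iff_null_sets null_sets_completionI)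
  qed
  moreover have "0 \<le> I" unfolding I_def using F_nonneg by simp
  moreover have "Ck k (\<lambda>x. inverse I * F x)" for k
    by (intro Ck_mult Ck_const F)
  moreover have "F (- x) = F x" for x by (simp add: F_def)
  ultimately have "mollifier \<delta> (\<lambda>x. inverse I * F x)"
    unfolding mollifier_def using F_nonneg F_zero int by (simp add: I_def)
  then show ?thesis using that by blast
qed

section \<open>Convolution\<close>

lemma integrable_cball:
  "integrable lborel (\<lambda>x::'a::euclidean_space. c * indicator (cball a R) x :: real)"
  using emeasure_lborel_cball_finite[of a R]
  by (intro integrable_mult_right integrable_real_indicator) auto

lemma integrable_bounded_support:
  fixes f :: "'a::euclidean_space \<Rightarrow> real"
  assumes [measurable]: "f \<in> borel_measurable borel"
    and "\<And>x. \<bar>f x\<bar> \<le> B" "\<And>x. norm x \<ge> R \<Longrightarrow> f x = 0"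
  shows "integrable lborel f"
proof (rule Bochner_Integration.integrable_bound)
  show "integrable lborel (\<lambda>x::'a. B * indicator (cball 0 R) x)"
    by (rule integrable_cball)
  have "B \<ge> 0" using assms(2)[of 0] by linarith
  then show "AE x in lborel. norm (f x) \<le> norm (B * indicator (cball 0 R) x)"
    using assms(2,3) by (intro AE_I2) (auto simp: indicator_def)
qed auto

lemma integral_translate:
  fixes f :: "'a::euclidean_space \<Rightarrow> real"
  assumes "f \<in> borel_measurable borel"
  shows "(LINT x|lborel. f (c + x)) = (LINT x|lborel. f x)"
    and "integrable lborel (\<lambda>x. f (c + x)) \<longleftrightarrow> integrable lborel f"
  using integral_distr[of "(+) c" lborel borel f] integrable_distr_eq[of "(+) c" lborel borel f] assms
  by (simp_all add: lborel_distr_plus)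

definition convolve :: "('a::euclidean_space \<Rightarrow> real) \<Rightarrow> ('a \<Rightarrow> real) \<Rightarrow> 'a \<Rightarrow> real" where
  "convolve \<eta> U x = (LINT y|lborel. U y * \<eta> (x - y))"

lemma convolve_measurable [measurable]:
  assumes [measurable]: "\<eta> \<in> borel_measurable borel" "U \<in> borel_measurable borel"
  shows "convolve \<eta> U \<in> borel_measurable borel"
  unfolding convolve_def by measurable

lemma convolve_integrable:
  fixes \<eta> U :: "'a::euclidean_space \<Rightarrow> real"
  assumes [measurable]: "\<eta> \<in> borel_measurable borel" "U \<in> borel_measurable borel"
    and "\<And>x. \<bar>U x\<bar> \<le> C" "\<And>x. \<bar>\<eta> x\<bar> \<le> B" "\<And>x. norm x \<ge> R \<Longrightarrow> \<eta> x = 0"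
  shows "integrable lborel (\<lambda>y. U y * \<eta> (x - y))"
proof (rule integrable_bounded_support[where B = "C * B" and R = "R + norm x"])
  show "\<bar>U y * \<eta> (x - y)\<bar> \<le> C * B" for y
    using mult_mono[of "\<bar>U y\<bar>" C "\<bar>\<eta> (x - y)\<bar>" B] assms(3)[of y] assms(4)[of "x - y"]
    by (simp add: abs_mult)
  show "U y * \<eta> (x - y) = 0" if "R + norm x \<le> norm y" for y
    using assms(5)[of "x - y"] that norm_triangle_ineq2[of y x] by (simp add: norm_minus_commute)
qed measurable

lemma convolve_bound:
  fixes \<eta> U :: "'a::euclidean_space \<Rightarrow> real"
  assumes [measurable]: "\<eta> \<in> borel_measurable borel" "U \<in> borel_measurable borel"
    and "\<And>x. \<bar>U x\<bar> \<le> C" "\<And>x. \<bar>\<eta> x\<bar> \<le> B" "\<And>x. norm x \<ge> R \<Longrightarrow> \<eta> x = 0" "R \<ge> 0"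
  shows "\<bar>convolve \<eta> U x\<bar> \<le> C * B * (unit_ball_vol DIM('a) * R ^ DIM('a))"
proof -
  have "C * B \<ge> 0" using assms(3)[of 0] assms(4)[of 0] by simp
  have "\<bar>convolve \<eta> U x\<bar> \<le> (LINT y|lborel. C * B * indicator (cball x R) y)"
    unfolding convolve_def real_norm_def[symmetric]
  proof (rule Bochner_Integration.integral_norm_bound_integral)
    show "integrable lborel (\<lambda>y. U y * \<eta> (x - y))"
      by (rule convolve_integrable) fact+
    show "integrable lborel (\<lambda>y. C * B * indicator (cball x R) y)"
      by (rule integrable_cball)
    show "norm (U y * \<eta> (x - y)) \<le> C * B * indicator (cball x R) y" for y
      using mult_mono[of "\<bar>U y\<bar>" C "\<bar>\<eta> (x - y)\<bar>" B] assms(3)[of y] assms(4)[of "x - y"]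
        assms(5)[of "x - y"]
      by (auto simp: abs_mult indicator_def dist_norm)
  qed
  also have "\<dots> = C * B * (unit_ball_vol DIM('a) * R ^ DIM('a))"
    using \<open>R \<ge> 0\<close> by (simp add: content_cball)
  finally show ?thesis .
qed

text \<open>The kernel varies while \<open>U\<close> stays fixed: translates and difference
  quotients of \<open>convolve \<eta> U\<close> are convolutions of \<open>U\<close> with translates
  and difference quotients of \<open>\<eta>\<close>. Continuity, first derivatives and second
  differences of convolutions thus reduce to pointwise convergence of kernels; the common bound and
  support provide the majorant.\<close>

lemma convolve_tendsto:
  assumes [measurable]: "\<And>n::nat. q n \<in> borel_measurable borel" "q0 \<in> borel_measurable borel"
      "U \<in> borel_measurable borel"
    and "\<And>x. \<bar>U x\<bar> \<le> C" "\<And>n z. \<bar>q n z\<bar> \<le> B" "\<And>n z. norm z \<ge> R \<Longrightarrow> q n z = 0"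
    and lim: "\<And>z. (\<lambda>n. q n z) \<longlonglongrightarrow> q0 z"
  shows "(\<lambda>n. convolve (q n) U x) \<longlonglongrightarrow> convolve q0 U x"
  unfolding convolve_def
proof (rule integral_dominated_convergence[where w = "\<lambda>y. C * B * indicator (cball x R) y"])
  show "integrable lborel (\<lambda>y. C * B * indicator (cball x R) y)"
    by (rule integrable_cball)
  show "AE y in lborel. norm (U y * q n (x - y)) \<le> C * B * indicator (cball x R) y" for n
    using assms(6)
    by (intro AE_I2) (auto simp: abs_mult indicator_def dist_norm
        intro!: mult_mono assms(4,5) order_trans[OF abs_ge_zero assms(4)])
  show "AE y in lborel. (\<lambda>n. U y * q n (x - y)) \<longlonglongrightarrow> U y * q0 (x - y)"
    by (intro AE_I2 tendsto_intros lim)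
qed measurable

lemma partial_zero_outside:
  assumes "open S" "x \<in> S" "\<And>y. y \<in> S \<Longrightarrow> \<phi> y = 0"
  shows "partial b \<phi> x = 0"
proof -
  have "(\<phi> has_derivative (\<lambda>h. 0)) (at x)"
    by (rule has_derivative_transform_within_open[OF has_derivative_const[of 0] assms(1,2)])
       (simp add: assms(3))
  then show ?thesis by (rule partial_eqI)
qed

lemma partial_zero_norm:
  assumes "\<And>y. norm y \<ge> R \<Longrightarrow> \<phi> y = 0" "norm x > R"
  shows "partial b \<phi> x = 0"
  using assms open_Collect_less[of "\<lambda>x::'a. R" norm]
  by (intro partial_zero_outside[of "{x. R < norm x}"]) (auto intro!: continuous_intros)

lemma lipschitz_along:
  fixes F D :: "'a::real_vector \<Rightarrow> real"
  assumes "\<And>s. ((\<lambda>t. F (x + t *\<^sub>R b)) has_real_derivative D (x + s *\<^sub>R b)) (at s)"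
    and "\<And>x. \<bar>D x\<bar> \<le> B"
  shows "\<bar>F (x + t *\<^sub>R b) - F x\<bar> \<le> B * \<bar>t\<bar>"
  using field_differentiable_bound[of UNIV "\<lambda>t. F (x + t *\<^sub>R b)" "\<lambda>s. D (x + s *\<^sub>R b)" B 0 t] assms
  by (auto simp: norm_minus_commute)

lemma convolve_has_partial:
  fixes \<eta> U :: "'a::euclidean_space \<Rightarrow> real"
  assumes C1: "Ck 1 \<eta>" and supp: "\<And>z. norm z \<ge> R \<Longrightarrow> \<eta> z = 0"
    and b: "b \<in> Basis"
    and U[measurable]: "U \<in> borel_measurable borel" and UC: "\<And>x. \<bar>U x\<bar> \<le> C"
  shows "((\<lambda>t. convolve \<eta> U (x + t *\<^sub>R b)) has_real_derivative convolve (partial b \<eta>) U x) (at 0)"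
proof -
  have diff: "\<forall>x. \<eta> differentiable (at x)" and contp: "continuous_on UNIV (partial b \<eta>)"
    using C1 b by auto
  have cont: "continuous_on UNIV \<eta>" using Ck_continuous[OF C1] .
  have [measurable]: "\<eta> \<in> borel_measurable borel" "partial b \<eta> \<in> borel_measurable borel"
    using cont contp by (auto intro: borel_measurable_continuous_onI)
  obtain B0 where B0: "\<And>x. \<bar>\<eta> x\<bar> \<le> B0"
    using bounded_continuous_bounded_support[OF cont supp] by blast
  obtain B where B: "\<And>x. \<bar>partial b \<eta> x\<bar> \<le> B"
  proof (rule bounded_continuous_bounded_support[OF contp])
    show "partial b \<eta> x = 0" if "R + 1 \<le> norm x" for x
      using that by (intro partial_zero_norm[of R] supp) auto
  qed (rule that)
  have lip: "\<bar>\<eta> (z + t *\<^sub>R b) - \<eta> z\<bar> \<le> B * \<bar>t\<bar>" for z t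
    by (rule lipschitz_along[where D = "partial b \<eta>", OF partial_along[OF diff] B])
  show ?thesis
    unfolding DERIV_def tendsto_at_iff_sequentially
  proof (intro allI impI)
    fix X :: "nat \<Rightarrow> real" assume X: "\<forall>i. X i \<in> UNIV - {0}" "X \<longlonglongrightarrow> 0"
    \<comment> \<open>A convergent sequence of steps is bounded by some \<open>M\<close>, so all
      difference quotients of the kernel vanish outside the common ball of radius
      \<open>R + M\<close>.\<close>
    obtain M where M: "\<And>n. \<bar>X n\<bar> \<le> M"
      using convergent_imp_Bseq[OF convergentI[OF X(2)]] by (auto simp: Bseq_def)
    define q where "q n z = (\<eta> (z + X n *\<^sub>R b) - \<eta> z) / X n" for n z
    have "(\<lambda>n. convolve (q n) U x) \<longlonglongrightarrow> convolve (partial b \<eta>) U x"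
    proof (rule convolve_tendsto[OF _ _ U UC])
      show "q n \<in> borel_measurable borel" for n unfolding q_def by measurable
      show "\<bar>q n z\<bar> \<le> B" for n z
        using lip[of z "X n"] X
        by (simp add: q_def divide_le_eq)
      show "q n z = 0" if "R + M \<le> norm z" for n z
      proof -
        have "norm z \<le> norm (z + X n *\<^sub>R b) + \<bar>X n\<bar>"
          using norm_triangle_ineq4[of "z + X n *\<^sub>R b" "X n *\<^sub>R b"] b by simp
        then have "norm (z + X n *\<^sub>R b) \<ge> R" "norm z \<ge> R" using that M[of n] by linarith+
        then show ?thesis by (simp add: q_def supp)
      qed
      show "(\<lambda>n. q n z) \<longlonglongrightarrow> partial b \<eta> z" for z
      proof -
        have "((\<lambda>t. (\<eta> (z + t *\<^sub>R b) - \<eta> z) / t) \<longlongrightarrow> partial b \<eta> z) (at 0)"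
          using partial_along[OF diff, of z b 0] by (simp add: DERIV_def)
        then show ?thesis
          using X unfolding tendsto_at_iff_sequentially by (auto simp: q_def comp_def)
      qed
    qed measurable
    moreover have "convolve (q n) U x
        = (convolve \<eta> U (x + (0 + X n) *\<^sub>R b) - convolve \<eta> U (x + 0 *\<^sub>R b)) / X n" for n
    proof -
      have "convolve (q n) U x
          = (LINT y|lborel. (U y * \<eta> (x + X n *\<^sub>R b - y) - U y * \<eta> (x - y)) / X n)"
        unfolding convolve_def q_def by (simp add: algebra_simps diff_divide_distrib)
      also have "\<dots> = (convolve \<eta> U (x + X n *\<^sub>R b) - convolve \<eta> U x) / X n"
        unfolding convolve_def
        using convolve_integrable[where U=U and \<eta>=\<eta>, OF _ _ UC B0 supp]
        by simp
      finally show ?thesis by simp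
    qed
    ultimately show "((\<lambda>h. (convolve \<eta> U (x + (0 + h) *\<^sub>R b) - convolve \<eta> U (x + 0 *\<^sub>R b)) / h) \<circ> X)
        \<longlonglongrightarrow> convolve (partial b \<eta>) U x" by (simp add: comp_def)
  qed
qed

text \<open>This takes the place of integration by parts. By translation invariance every difference
  quotient of \<open>F\<close> has integral zero, and dominated convergence passes this to the
  derivative.\<close>

lemma integral_directional_derivative_zero:
  fixes F D :: "'a::euclidean_space \<Rightarrow> real"
  assumes [measurable]: "F \<in> borel_measurable borel"
    and D: "\<And>x. ((\<lambda>t. F (x + t *\<^sub>R b)) has_real_derivative D x) (at 0)"
    and DB: "\<And>x. \<bar>D x\<bar> \<le> B" and FB: "\<And>x. \<bar>F x\<bar> \<le> B'" and supp: "\<And>x. norm x \<ge> R \<Longrightarrow> F x = 0"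
  shows "(LINT x|lborel. D x) = 0"
proof -
  define X :: "nat \<Rightarrow> real" where "X n = inverse (real (Suc n))" for n
  have X: "X \<longlonglongrightarrow> 0" "X n > 0" "X n \<le> 1" for n
    using LIMSEQ_inverse_real_of_nat by (simp_all add: X_def[abs_def] field_simps)
  define q where "q n x = (F (x + X n *\<^sub>R b) - F x) / X n" for n x
  have [measurable]: "q n \<in> borel_measurable borel" for n unfolding q_def by measurable
  have lim: "(\<lambda>n. q n x) \<longlonglongrightarrow> D x" for x
  proof -
    have "((\<lambda>t. (F (x + t *\<^sub>R b) - F x) / t) \<longlongrightarrow> D x) (at 0)"
      using D[of x] by (simp add: DERIV_def)
    then show ?thesis
      using X(1) less_imp_neq[OF X(2)] unfolding tendsto_at_iff_sequentially
      by (auto simp: q_def comp_def)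
  qed
  have [measurable]: "D \<in> borel_measurable borel"
    by (rule borel_measurable_LIMSEQ_real[OF lim]) auto
  have B: "B \<ge> 0" using DB[of 0] by linarith
  \<comment> \<open>The derivative at parameter 0 is assumed at every base point; moving the base
    point gives it at every parameter, as the Lipschitz bound requires.\<close>
  have "((\<lambda>t. F (x + t *\<^sub>R b)) has_real_derivative D (x + s *\<^sub>R b)) (at s)" for x s
    using DERIV_shift[of "\<lambda>t. F (x + t *\<^sub>R b)" "D (x + s *\<^sub>R b)" 0 s] D[of "x + s *\<^sub>R b"]
    by (simp add: algebra_simps)
  from lipschitz_along[OF this DB] have lip: "\<bar>F (x + t *\<^sub>R b) - F x\<bar> \<le> B * \<bar>t\<bar>" for x t .
  have "(\<lambda>n. LINT x|lborel. q n x) \<longlonglongrightarrow> (LINT x|lborel. D x)"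
  proof (rule integral_dominated_convergence[where w = "\<lambda>y. B * indicator (cball 0 (R + norm b)) y"])
    show "integrable lborel (\<lambda>y::'a. B * indicator (cball 0 (R + norm b)) y)"
      by (rule integrable_cball)
    have "\<bar>q n x\<bar> \<le> B" for n x
      using lip[of x "X n"] X(2)[of n] by (simp add: q_def divide_le_eq)
    moreover have "q n x = 0" if "R + norm b < norm x" for n x
    proof -
      have "norm x \<le> norm (x + X n *\<^sub>R b) + X n * norm b"
        using norm_triangle_ineq4[of "x + X n *\<^sub>R b" "X n *\<^sub>R b"] X(2)[of n] by simp
      moreover have "X n * norm b \<le> norm b"
        using X(3)[of n] X(2)[of n] mult_right_mono[of "X n" 1 "norm b"] by simp
      ultimately have "norm (x + X n *\<^sub>R b) \<ge> R" "norm x \<ge> R" using that norm_ge_zero[of b] by linarith+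
      then show ?thesis by (simp add: q_def supp)
    qed
    ultimately show "AE x in lborel. norm (q n x) \<le> B * indicator (cball 0 (R + norm b)) x" for n
      using B by (intro AE_I2) (auto simp: indicator_def)
  qed (use lim in auto)
  moreover have "(LINT x|lborel. q n x) = 0" for n
  proof -
    have int: "integrable lborel F" by (rule integrable_bounded_support[OF _ FB supp]) auto
    then have "integrable lborel (\<lambda>x. F (X n *\<^sub>R b + x))"
      by (simp add: integral_translate)
    with int show ?thesis
      using integral_translate(1)[of F "X n *\<^sub>R b"] by (simp add: q_def add.commute)
  qed
  ultimately show ?thesis by (simp add: LIMSEQ_const_iff)
qed

lemma mollifierD:
  assumes "mollifier \<delta> \<eta>"
  shows "Ck k \<eta>" "0 \<le> \<eta> x" "\<eta> (x - y) = \<eta> (y - x)" "norm x \<ge> \<delta> \<Longrightarrow> \<eta> x = 0"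
    "continuous_on UNIV \<eta>" "\<eta> \<in> borel_measurable borel" "(LINT x|lborel. \<eta> x) = 1"
proof -
  show "\<eta> (x - y) = \<eta> (y - x)"
    using assms unfolding mollifier_def by (metis minus_diff_eq)
  show c: "continuous_on UNIV \<eta>"
    using assms Ck_continuous[of 0 \<eta>] unfolding mollifier_def by blast
  show "\<eta> \<in> borel_measurable borel"
    using c by (rule borel_measurable_continuous_onI)
qed (use assms in \<open>auto simp: mollifier_def\<close>)

text \<open>The weights \<open>\<eta> (x - y)\<close> are nonnegative with total mass 1, so an
  average stays as close to \<open>c\<close> as the averaged function is on the support. With
  \<open>c = 0\<close> this is also the bound preserving the sup norm.\<close>

lemma mollifier_average:
  assumes \<eta>: "mollifier \<delta> \<eta>" and [measurable]: "p \<in> borel_measurable borel"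
    and near: "\<And>x. norm (x - y) < \<delta> \<Longrightarrow> \<bar>p x - c\<bar> \<le> e"
  shows "\<bar>(LINT x|lborel. p x * \<eta> (x - y)) - c\<bar> \<le> e"
    and "integrable lborel (\<lambda>x. p x * \<eta> (x - y))"
proof -
  note [measurable] = mollifierD(6)[OF \<eta>]
  \<comment> \<open>The integral of a non-integrable function is 0 by convention, so the value 1
    already forces integrability.\<close>
  have "integrable lborel \<eta>"
    using mollifierD(7)[OF \<eta>] not_integrable_integral_eq[of lborel \<eta>] by linarith
  then have i\<eta>: "integrable lborel (\<lambda>x. \<eta> (x - y))"
    using integral_translate(2)[OF mollifierD(6)[OF \<eta>], of "- y"] by simp
  have I: "(LINT x|lborel. \<eta> (x - y)) = 1"
    using integral_translate(1)[OF mollifierD(6)[OF \<eta>], of "- y"] mollifierD(7)[OF \<eta>] by simp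
  have le: "\<bar>(p x - c) * \<eta> (x - y)\<bar> \<le> e * \<eta> (x - y)" for x
    using near[of x] mollifierD(2,4)[OF \<eta>, of "x - y"]
    by (cases "norm (x - y) < \<delta>") (auto simp: abs_mult mult_right_mono)
  have ie: "integrable lborel (\<lambda>x. e * \<eta> (x - y))" using i\<eta> by simp
  have i: "integrable lborel (\<lambda>x. (p x - c) * \<eta> (x - y))"
    by (rule Bochner_Integration.integrable_bound[OF ie])
       (use order_trans[OF le abs_ge_self] in \<open>simp_all only: real_norm_def eventually_True, measurable\<close>)
  have eq: "p x * \<eta> (x - y) = (p x - c) * \<eta> (x - y) + c * \<eta> (x - y)" for x
    by (simp add: algebra_simps)
  show "integrable lborel (\<lambda>x. p x * \<eta> (x - y))"
    unfolding eq using i i\<eta> by simp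
  have "(LINT x|lborel. p x * \<eta> (x - y)) - c = (LINT x|lborel. (p x - c) * \<eta> (x - y))"
    unfolding eq using i i\<eta> I by simp
  also have "\<bar>\<dots>\<bar> \<le> (LINT x|lborel. e * \<eta> (x - y))"
    unfolding real_norm_def[symmetric]
    by (rule Bochner_Integration.integral_norm_bound_integral[OF i ie]) (use le in simp)
  finally show "\<bar>(LINT x|lborel. p x * \<eta> (x - y)) - c\<bar> \<le> e" using I by simp
qed

lemma convolve_average:
  assumes \<eta>: "mollifier \<delta> \<eta>" and "U \<in> borel_measurable borel"
    and "\<And>y. norm (y - x) < \<delta> \<Longrightarrow> \<bar>U y - c\<bar> \<le> e"
  shows "\<bar>convolve \<eta> U x - c\<bar> \<le> e"
proof -
  have "convolve \<eta> U x = (LINT y|lborel. U y * \<eta> (y - x))"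
    unfolding convolve_def by (intro Bochner_Integration.integral_cong refl) (metis mollifierD(3)[OF \<eta>])
  then show ?thesis using mollifier_average(1)[OF assms] by simp
qed

text \<open>Joint integrability holds because the inner integral of the absolute value is bounded by
  a multiple of the L^1 norm of \<open>H\<close> and vanishes for \<open>x\<close> outside the ball
  of radius \<open>R\<close>.\<close>

lemma convolve_Fubini:
  fixes p H \<eta> :: "'a::euclidean_space \<Rightarrow> real"
  assumes [measurable]: "p \<in> borel_measurable borel" "\<eta> \<in> borel_measurable borel"
    and pB: "\<And>x. \<bar>p x\<bar> \<le> B" and supp: "\<And>x. norm x \<ge> R \<Longrightarrow> p x = 0"
    and \<eta>B: "\<And>x. \<bar>\<eta> x\<bar> \<le> B'" and H: "integrable lborel H"
  shows "(LINT x|lborel. p x * convolve \<eta> H x) = (LINT y|lborel. H y * (LINT x|lborel. p x * \<eta> (x - y)))"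
proof -
  have [measurable]: "H \<in> borel_measurable borel" using H by auto
  have nn: "B \<ge> 0" "B' \<ge> 0" using pB[of 0] \<eta>B[of 0] by linarith+
  let ?f = "\<lambda>x y. p x * (H y * \<eta> (x - y))"
  have bd: "\<bar>?f x y\<bar> \<le> B * B' * \<bar>H y\<bar>" for x y
    using mult_mono[OF pB[of x] \<eta>B[of "x - y"]] nn mult_right_mono[of "\<bar>p x\<bar> * \<bar>\<eta> (x - y)\<bar>" "B * B'" "\<bar>H y\<bar>"]
    by (simp add: abs_mult mult_ac)
  have iH: "integrable lborel (\<lambda>y. B * B' * \<bar>H y\<bar>)" using H by simp
  have i: "integrable lborel (?f x)" for x
    by (rule Bochner_Integration.integrable_bound[OF iH]) (use order_trans[OF bd abs_ge_self] in \<open>simp_all only: real_norm_def eventually_True, measurable\<close>)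
  have "integrable (lborel \<Otimes>\<^sub>M lborel) (case_prod ?f)"
  proof (rule lborel_pair.Fubini_integrable)
    show "integrable lborel (\<lambda>x. LINT y|lborel. norm (case (x, y) of (x, y) \<Rightarrow> ?f x y))"
    proof (rule integrable_bounded_support[where B = "LINT y|lborel. B * B' * \<bar>H y\<bar>" and R = R])
      show "\<bar>LINT y|lborel. norm (case (x, y) of (x, y) \<Rightarrow> ?f x y)\<bar> \<le> (LINT y|lborel. B * B' * \<bar>H y\<bar>)" for x
        unfolding real_norm_def[symmetric] prod.case
        by (rule Bochner_Integration.integral_norm_bound_integral[OF integrable_norm[OF i] iH[unfolded real_norm_def[symmetric]]])
           (use bd in simp)
    qed (auto simp: supp)
  qed (use i in auto)
  from lborel_pair.Fubini_integral[OF this]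
  have "(LINT x|lborel. p x * convolve \<eta> H x) = (LINT y|lborel. LINT x|lborel. ?f x y)"
    by (simp add: convolve_def)
  also have "\<dots> = (LINT y|lborel. LINT x|lborel. H y * (p x * \<eta> (x - y)))"
    by (simp only: mult.left_commute)
  finally show ?thesis by simp
qed

section \<open>The chain rule for weak derivatives\<close>

lemma continuous_bounded_on_interval:
  fixes f :: "real \<Rightarrow> real"
  assumes "continuous_on UNIV f"
  obtains B where "\<And>s. \<bar>s\<bar> \<le> C \<Longrightarrow> \<bar>f s\<bar> \<le> B"
proof -
  have "compact (f ` {-C..C})"
    by (intro compact_continuous_image continuous_on_subset[OF assms]) auto
  then obtain B where B: "\<And>x. x \<in> f ` {-C..C} \<Longrightarrow> norm x \<le> B"
    using compact_imp_bounded bounded_iff by metis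
  show ?thesis
  proof (rule that[of B])
    fix s assume "\<bar>s\<bar> \<le> C"
    then show "\<bar>f s\<bar> \<le> B" using B[of "f s"] by (simp add: abs_le_iff)
  qed
qed

text \<open>With \<open>U\<close> mollified, the chain rule is classical. By Fubini the mollifier of the weak derivative
  \<open>H\<close> is moved to the other factor, which is continuous, so that pointwise convergence of mollified
  continuous functions and dominated convergence suffice.\<close>

lemma weak_chain_rule:
  fixes U \<psi> H :: "'a::euclidean_space \<Rightarrow> real" and A a :: "real \<Rightarrow> real"
  assumes U: "continuous_on UNIV U" and UC: "\<And>x. \<bar>U x\<bar> \<le> C"
    and A: "\<And>s. (A has_real_derivative a s) (at s)" and a: "continuous_on UNIV a"
    and b: "b \<in> Basis" and \<psi>: "Ck 1 \<psi>" and K: "compact K" and \<psi>K: "\<And>x. x \<notin> K \<Longrightarrow> \<psi> x = 0"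
    and H: "integrable lborel H" and d: "d > 0"
    and weak: "\<And>\<delta> \<eta> x. mollifier \<delta> \<eta> \<Longrightarrow> 0 < \<delta> \<Longrightarrow> \<delta> \<le> d \<Longrightarrow> x \<in> K \<Longrightarrow>
        convolve (partial b \<eta>) U x = convolve \<eta> H x"
  shows "(LINT x|lborel. A (U x) * partial b \<psi> x) = - (LINT x|lborel. H x * (a (U x) * \<psi> x))"
proof -
  define \<delta> where "\<delta> n = d * inverse (real (Suc n))" for n
  have \<delta>: "\<delta> \<longlonglongrightarrow> 0" "\<delta> n > 0" "\<delta> n \<le> d" for n
  proof -
    have "(\<lambda>n. d * inverse (real (Suc n))) \<longlonglongrightarrow> d * 0"
      by (intro tendsto_intros LIMSEQ_inverse_real_of_nat)
    then show "\<delta> \<longlonglongrightarrow> 0" by (simp add: \<delta>_def[abs_def])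
  qed (use d in \<open>auto simp: \<delta>_def field_simps\<close>)
  have "\<forall>n. \<exists>\<eta>::'a \<Rightarrow> real. mollifier (\<delta> n) \<eta>" using mollifier_exists \<delta>(2) by metis
  then obtain \<eta> :: "nat \<Rightarrow> 'a \<Rightarrow> real" where \<eta>: "\<And>n. mollifier (\<delta> n) (\<eta> n)" by metis
  define u where "u n = convolve (\<eta> n) U" for n
  have contA: "continuous_on UNIV A"
    using A by (meson DERIV_isCont continuous_at_imp_continuous_on)
  have cont\<psi>: "continuous_on UNIV \<psi>" using Ck_continuous[OF \<psi>] .
  have cont\<psi>': "continuous_on UNIV (partial b \<psi>)" and diff\<psi>: "\<forall>x. \<psi> differentiable (at x)"
    using \<psi> b by auto
  have [measurable]: "U \<in> borel_measurable borel" "A \<in> borel_measurable borel" "a \<in> borel_measurable borel"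
    "\<psi> \<in> borel_measurable borel" "partial b \<psi> \<in> borel_measurable borel" "\<eta> n \<in> borel_measurable borel"
    "H \<in> borel_measurable borel" for n
    using U contA a cont\<psi> cont\<psi>' mollifierD(6)[OF \<eta>] H by (auto intro: borel_measurable_continuous_onI)
  have [measurable]: "u n \<in> borel_measurable borel" for n unfolding u_def by measurable
  have uC: "\<bar>u n x\<bar> \<le> C" for n x
    using convolve_average[OF \<eta>[of n], of U x 0 C] UC by (simp add: u_def)
  have near: "\<forall>\<^sub>F n in sequentially. \<forall>x. norm (x - y) < \<delta> n \<longrightarrow> \<bar>u n x - U y\<bar> \<le> e" if "e > 0" for e y
  proof -
    have "isCont U y" using U by (simp add: continuous_on_eq_continuous_at)
    then obtain r where r: "r > 0" "\<And>z. dist z y < r \<Longrightarrow> dist (U z) (U y) < e"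
      using \<open>e > 0\<close> unfolding continuous_at_eps_delta by blast
    \<comment> \<open>Half of \<open>r\<close>, because two displacements add up: \<open>x\<close>
      is within \<open>\<delta> n\<close> of \<open>y\<close>, and the points averaged at
      \<open>x\<close> are within \<open>\<delta> n\<close> of \<open>x\<close>.\<close>
    have "\<forall>\<^sub>F n in sequentially. \<delta> n < r / 2"
      using order_tendstoD(2)[OF \<delta>(1) half_gt_zero[OF r(1)]] .
    then show ?thesis
    proof eventually_elim
      fix n assume n: "\<delta> n < r / 2"
      show "\<forall>x. norm (x - y) < \<delta> n \<longrightarrow> \<bar>u n x - U y\<bar> \<le> e"
      proof (intro allI impI)
        fix x assume x: "norm (x - y) < \<delta> n"
        show "\<bar>u n x - U y\<bar> \<le> e"
          unfolding u_def
        proof (rule convolve_average[OF \<eta>])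
          fix z assume "norm (z - x) < \<delta> n"
          then have "dist z y < r" using norm_triangle_ineq[of "z - x" "x - y"] x n by (simp add: dist_norm)
          then show "\<bar>U z - U y\<bar> \<le> e" using r(2) by (auto simp: dist_norm less_imp_le)
        qed simp
      qed
    qed
  qed
  have u_lim: "(\<lambda>n. u n x) \<longlonglongrightarrow> U x" for x
  proof (rule tendstoI)
    fix e :: real assume "e > 0"
    then have "\<forall>\<^sub>F n in sequentially. \<bar>u n x - U x\<bar> \<le> e / 2"
      using near[of "e / 2" x] \<delta>(2) by (auto elim!: eventually_mono)
    then show "\<forall>\<^sub>F n in sequentially. dist (u n x) (U x) < e"
      using \<open>e > 0\<close> by (auto elim!: eventually_mono simp: dist_real_def)
  qed
  obtain BA where BA: "\<And>s. \<bar>s\<bar> \<le> C \<Longrightarrow> \<bar>A s\<bar> \<le> BA"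
    using continuous_bounded_on_interval[OF contA] by blast
  obtain Ba where Ba: "\<And>s. \<bar>s\<bar> \<le> C \<Longrightarrow> \<bar>a s\<bar> \<le> Ba"
    using continuous_bounded_on_interval[OF a] by blast
  have "C \<ge> 0" using UC[of 0] by linarith
  then have "BA \<ge> 0" "Ba \<ge> 0" using BA[of 0] Ba[of 0] by linarith+
  obtain R where R: "\<And>x. x \<in> K \<Longrightarrow> norm x < R" "R > 0"
    using compact_imp_bounded[OF K] unfolding bounded_pos_less by blast
  have \<psi>R: "\<psi> x = 0" if "norm x \<ge> R" for x using R \<psi>K that by fastforce
  have \<psi>'K: "partial b \<psi> x = 0" if "x \<notin> K" for x
    using that \<psi>K compact_imp_closed[OF K] by (intro partial_zero_outside[of "- K"]) auto
  then have \<psi>'R: "partial b \<psi> x = 0" if "norm x \<ge> R" for x using R that by fastforce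
  obtain B\<psi> where B\<psi>: "\<And>x. \<bar>\<psi> x\<bar> \<le> B\<psi>"
    using bounded_continuous_bounded_support[OF cont\<psi> \<psi>R] by blast
  obtain B\<psi>' where B\<psi>': "\<And>x. \<bar>partial b \<psi> x\<bar> \<le> B\<psi>'"
    using bounded_continuous_bounded_support[OF cont\<psi>' \<psi>'R] by blast
  define p where "p n x = a (u n x) * \<psi> x" for n x
  have [measurable]: "p n \<in> borel_measurable borel" for n unfolding p_def by measurable
  have pB: "\<bar>p n x\<bar> \<le> Ba * B\<psi>" for n x
    unfolding p_def abs_mult using Ba[OF uC] B\<psi> \<open>Ba \<ge> 0\<close> by (intro mult_mono) auto
  have AB: "\<bar>A (u n x) * partial b \<psi> x\<bar> \<le> BA * B\<psi>'" for n x
    unfolding abs_mult using BA[OF uC] B\<psi>' \<open>BA \<ge> 0\<close> by (intro mult_mono) auto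
  \<comment> \<open>For fixed \<open>n\<close> the classical product and chain rules apply to
    \<open>A (u n x) * \<psi> x\<close>, whose directional derivative integrates to zero. On
    \<open>K\<close> the derivative of \<open>u n\<close> is then the mollified \<open>H\<close>;
    off \<open>K\<close> the factor \<open>\<psi>\<close> removes it.\<close>
  have step: "(LINT x|lborel. A (u n x) * partial b \<psi> x) =
      - (LINT y|lborel. H y * (LINT x|lborel. p n x * \<eta> n (x - y)))" for n
  proof -
    define V where "V = convolve (partial b (\<eta> n)) U"
    have C1: "Ck 1 (\<eta> n)" using mollifierD(1)[OF \<eta>] .
    have contp: "continuous_on UNIV (partial b (\<eta> n))" using C1 b by simp
    have [measurable]: "partial b (\<eta> n) \<in> borel_measurable borel"
      using contp by (rule borel_measurable_continuous_onI)
    have supp: "partial b (\<eta> n) x = 0" if "\<delta> n + 1 \<le> norm x" for x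
      using that mollifierD(4)[OF \<eta>] by (intro partial_zero_norm[of "\<delta> n"]) auto
    obtain B1 where B1: "\<And>x. \<bar>partial b (\<eta> n) x\<bar> \<le> B1"
      using bounded_continuous_bounded_support[OF contp supp] by blast
    define BV where "BV = C * B1 * (unit_ball_vol DIM('a) * (\<delta> n + 1) ^ DIM('a))"
    have BV: "\<bar>V x\<bar> \<le> BV" for x
      unfolding V_def BV_def using \<delta>(2)[of n] by (intro convolve_bound[OF _ _ UC B1 supp]) auto
    have [measurable]: "V \<in> borel_measurable borel" unfolding V_def by measurable
    have pVB: "\<bar>p n x * V x\<bar> \<le> Ba * B\<psi> * BV" for x
      unfolding abs_mult[of "p n x"] using pB[of n x] BV[of x] pB[of n 0] by (intro mult_mono) auto
    have du: "((\<lambda>t. u n (x + t *\<^sub>R b)) has_real_derivative V x) (at 0)" for x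
      unfolding u_def V_def
      by (rule convolve_has_partial[OF C1 mollifierD(4)[OF \<eta>] b _ UC]) auto
    have "(LINT x|lborel. A (u n x) * partial b \<psi> x + p n x * V x) = 0"
    proof (rule integral_directional_derivative_zero[where F = "\<lambda>x. A (u n x) * \<psi> x" and b = b and R = R])
      fix x
      have d1: "((\<lambda>t. A (u n (x + t *\<^sub>R b))) has_real_derivative a (u n x) * V x) (at 0)"
        using DERIV_chain2[OF A du] by simp
      have d2: "((\<lambda>t. \<psi> (x + t *\<^sub>R b)) has_real_derivative partial b \<psi> x) (at 0)"
        using partial_along[OF diff\<psi>, of x b 0] by simp
      show "((\<lambda>t. A (u n (x + t *\<^sub>R b)) * \<psi> (x + t *\<^sub>R b)) has_real_derivative
          A (u n x) * partial b \<psi> x + p n x * V x) (at 0)"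
        using DERIV_mult[OF d1 d2] by (simp add: p_def algebra_simps)
      show "\<bar>A (u n x) * partial b \<psi> x + p n x * V x\<bar> \<le> BA * B\<psi>' + Ba * B\<psi> * BV"
        using AB[of n x] pVB[of x] by linarith
      show "\<bar>A (u n x) * \<psi> x\<bar> \<le> BA * B\<psi>"
        unfolding abs_mult using BA[OF uC] B\<psi> \<open>BA \<ge> 0\<close> by (intro mult_mono) auto
      show "norm x \<ge> R \<Longrightarrow> A (u n x) * \<psi> x = 0" using \<psi>R by simp
    qed measurable
    moreover have "integrable lborel (\<lambda>x. A (u n x) * partial b \<psi> x)"
      by (rule integrable_bounded_support[OF _ AB]) (use \<psi>'R in auto)
    moreover have "integrable lborel (\<lambda>x. p n x * V x)"
      by (rule integrable_bounded_support[OF _ pVB]) (use \<psi>R in \<open>auto simp: p_def\<close>)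
    ultimately have "(LINT x|lborel. A (u n x) * partial b \<psi> x) = - (LINT x|lborel. p n x * V x)"
      by simp
    also have "(\<lambda>x. p n x * V x) = (\<lambda>x. p n x * convolve (\<eta> n) H x)"
    proof
      fix x show "p n x * V x = p n x * convolve (\<eta> n) H x"
        using weak[OF \<eta> \<delta>(2,3)] \<psi>K by (cases "x \<in> K") (auto simp: V_def p_def)
    qed
    also have "(LINT x|lborel. p n x * convolve (\<eta> n) H x)
        = (LINT y|lborel. H y * (LINT x|lborel. p n x * \<eta> n (x - y)))"
    proof -
      obtain B2 where B2: "\<And>x. \<bar>\<eta> n x\<bar> \<le> B2"
        using bounded_continuous_bounded_support[OF mollifierD(5,4)[OF \<eta>]] by blast
      show ?thesis
        by (rule convolve_Fubini[OF _ _ pB _ B2 H]) (use \<psi>R in \<open>auto simp: p_def\<close>)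
    qed
    finally show ?thesis .
  qed
  have "(\<lambda>n. LINT x|lborel. A (u n x) * partial b \<psi> x) \<longlonglongrightarrow> (LINT x|lborel. A (U x) * partial b \<psi> x)"
  proof (rule integral_dominated_convergence[where w = "\<lambda>y. BA * B\<psi>' * indicator (cball 0 R) y"])
    show "integrable lborel (\<lambda>y::'a. BA * B\<psi>' * indicator (cball 0 R) y)" by (rule integrable_cball)
    show "AE x in lborel. norm (A (u n x) * partial b \<psi> x) \<le> BA * B\<psi>' * indicator (cball 0 R) x" for n
      using AB[of n] \<psi>'R by (intro AE_I2) (auto simp: indicator_def)
    show "AE x in lborel. (\<lambda>n. A (u n x) * partial b \<psi> x) \<longlonglongrightarrow> A (U x) * partial b \<psi> x"
      by (intro AE_I2 tendsto_mult tendsto_const continuous_on_tendsto_compose[OF contA u_lim]) auto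
  qed measurable
  moreover have "(\<lambda>n. LINT y|lborel. H y * (LINT x|lborel. p n x * \<eta> n (x - y)))
      \<longlonglongrightarrow> (LINT y|lborel. H y * (a (U y) * \<psi> y))"
  proof (rule integral_dominated_convergence[where w = "\<lambda>y. Ba * B\<psi> * \<bar>H y\<bar>"])
    show "integrable lborel (\<lambda>y. Ba * B\<psi> * \<bar>H y\<bar>)" using H by simp
    have "\<bar>LINT x|lborel. p n x * \<eta> n (x - y)\<bar> \<le> Ba * B\<psi>" for n y
      using mollifier_average(1)[OF \<eta>[of n], of "p n" y 0 "Ba * B\<psi>"] pB by simp
    then show "AE y in lborel. norm (H y * (LINT x|lborel. p n x * \<eta> n (x - y))) \<le> Ba * B\<psi> * \<bar>H y\<bar>" for n
      unfolding real_norm_def abs_mult by (intro AE_I2) (subst mult.commute, rule mult_right_mono, auto)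
    have "(\<lambda>n. LINT x|lborel. p n x * \<eta> n (x - y)) \<longlonglongrightarrow> a (U y) * \<psi> y" for y
    proof (rule tendstoI)
      fix e :: real assume "e > 0"
      \<comment> \<open>Two things move at once in \<open>p n x\<close>: the point \<open>x\<close>
        near \<open>y\<close> and the value \<open>u n x\<close> near \<open>U y\<close>. Joint
        continuity at \<open>(U y, y)\<close> controls both.\<close>
      have "continuous_on UNIV (\<lambda>z. a (fst z) * \<psi> (snd z))"
        by (intro continuous_intros continuous_on_compose2[OF a] continuous_on_compose2[OF cont\<psi>]) auto
      then have "isCont (\<lambda>z. a (fst z) * \<psi> (snd z)) (U y, y)"
        by (simp add: continuous_on_eq_continuous_at)
      then obtain r where r: "r > 0"
        "\<And>s x. dist (s, x) (U y, y) < r \<Longrightarrow> dist (a s * \<psi> x) (a (U y) * \<psi> y) < e / 2"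
        using \<open>e > 0\<close> unfolding continuous_at_eps_delta by (metis fst_conv snd_conv half_gt_zero)
      have "\<forall>\<^sub>F n in sequentially. \<delta> n < r / 2"
        using order_tendstoD(2)[OF \<delta>(1) half_gt_zero[OF r(1)]] .
      moreover have "\<forall>\<^sub>F n in sequentially. \<forall>x. norm (x - y) < \<delta> n \<longrightarrow> \<bar>u n x - U y\<bar> \<le> r / 2"
        using near[OF half_gt_zero[OF r(1)]] .
      ultimately show "\<forall>\<^sub>F n in sequentially. dist (LINT x|lborel. p n x * \<eta> n (x - y)) (a (U y) * \<psi> y) < e"
      proof eventually_elim
        fix n assume n: "\<delta> n < r / 2" "\<forall>x. norm (x - y) < \<delta> n \<longrightarrow> \<bar>u n x - U y\<bar> \<le> r / 2"
        have "\<bar>(LINT x|lborel. p n x * \<eta> n (x - y)) - a (U y) * \<psi> y\<bar> \<le> e / 2"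
        proof (rule mollifier_average(1)[OF \<eta>])
          fix x assume x: "norm (x - y) < \<delta> n"
          have "dist (u n x, x) (U y, y) \<le> dist (u n x) (U y) + dist x y"
            by (simp add: dist_Pair_Pair sqrt_sum_squares_le_sum)
          also have "\<dots> < r" using n x by (fastforce simp: dist_norm)
          finally show "\<bar>p n x - a (U y) * \<psi> y\<bar> \<le> e / 2"
            using r(2) by (auto simp: dist_norm p_def less_imp_le)
        qed measurable
        then show "dist (LINT x|lborel. p n x * \<eta> n (x - y)) (a (U y) * \<psi> y) < e"
          using \<open>e > 0\<close> by (simp add: dist_norm)
      qed
    qed
    then show "AE y in lborel. (\<lambda>n. H y * (LINT x|lborel. p n x * \<eta> n (x - y))) \<longlonglongrightarrow> H y * (a (U y) * \<psi> y)"
      by (intro AE_I2 tendsto_intros)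
  qed measurable
  ultimately show ?thesis
    unfolding step using LIMSEQ_unique tendsto_minus by blast
qed

section \<open>The weak maximum principle\<close>

text \<open>The bound comes from applying the mean value inequality twice, the limit from one
  application of l'Hopital's rule followed by the definition of the derivative of \<open>g'\<close>
  at 0. The bound serves as the majorant for the kernels.\<close>

lemma second_difference:
  fixes g g' g'' :: "real \<Rightarrow> real"
  assumes g: "\<And>s. (g has_real_derivative g' s) (at s)"
    and g': "\<And>s. (g' has_real_derivative g'' s) (at s)"
  shows "\<And>B t. (\<And>s. \<bar>g'' s\<bar> \<le> B) \<Longrightarrow> \<bar>g t + g (- t) - 2 * g 0\<bar> \<le> 2 * B * t\<^sup>2"
    and "((\<lambda>t. (g t + g (- t) - 2 * g 0) / t\<^sup>2) \<longlongrightarrow> g'' 0) (at_right 0)"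
proof -
  have d: "((\<lambda>t. g t + g (- t) - 2 * g 0) has_real_derivative (g' s - g' (- s))) (at s)" for s
    by (auto intro!: derivative_eq_intros g DERIV_chain2[OF g])
  show "\<bar>g t + g (- t) - 2 * g 0\<bar> \<le> 2 * B * t\<^sup>2" if B: "\<And>s. \<bar>g'' s\<bar> \<le> B" for B t
  proof -
    have "norm (g t + g (- t) - 2 * g 0 - (g 0 + g (- 0) - 2 * g 0)) \<le> (2 * B * \<bar>t\<bar>) * norm (t - 0)"
    proof (rule field_differentiable_bound[where S = "{-\<bar>t\<bar>..\<bar>t\<bar>}"])
      fix s assume s: "s \<in> {-\<bar>t\<bar>..\<bar>t\<bar>}"
      have "norm (g' s - g' (- s)) \<le> B * norm (s - - s)"
        by (rule field_differentiable_bound[where S = UNIV and f' = g''])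
           (use B g' in \<open>auto intro: has_field_derivative_at_within\<close>)
      also have "\<dots> = 2 * B * \<bar>s\<bar>" by (simp add: abs_mult)
      also have "\<dots> \<le> 2 * B * \<bar>t\<bar>"
        using s B[of 0] by (intro mult_left_mono) auto
      finally show "norm (g' s - g' (- s)) \<le> 2 * B * \<bar>t\<bar>" .
    qed (auto intro: has_field_derivative_at_within d)
    then show ?thesis by (simp add: power2_eq_square abs_mult[symmetric])
  qed
  show "((\<lambda>t. (g t + g (- t) - 2 * g 0) / t\<^sup>2) \<longlongrightarrow> g'' 0) (at_right 0)"
  proof (rule lhopital_right_0)
    have "((\<lambda>t. g t + g (- t) - 2 * g 0) \<longlongrightarrow> g 0 + g (- 0) - 2 * g 0) (at 0)"
      using DERIV_isCont[OF d[of 0]] by (simp add: isCont_def)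
    then show "((\<lambda>t. g t + g (- t) - 2 * g 0) \<longlongrightarrow> 0) (at_right 0)"
      by (simp add: filterlim_at_split)
    show "((\<lambda>t::real. t\<^sup>2) \<longlongrightarrow> 0) (at_right 0)"
      by (auto intro!: tendsto_eq_intros)
    show "\<forall>\<^sub>F t in at_right 0. ((\<lambda>t. g t + g (- t) - 2 * g 0) has_real_derivative (g' t - g' (- t))) (at t)"
      using d by simp
    show "\<forall>\<^sub>F t in at_right 0. ((\<lambda>t. t\<^sup>2) has_real_derivative (2 * t)) (at (t::real))"
      by (intro always_eventually allI) (auto intro!: derivative_eq_intros)
    \<comment> \<open>The quotient left by l'Hopital's rule is the mean of the difference quotients
      of \<open>g'\<close> at 0 with steps \<open>t\<close> and \<open>- t\<close>.\<close>
    have 1: "((\<lambda>t. (g' t - g' 0) / t) \<longlongrightarrow> g'' 0) (at 0)"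
      using g'[of 0] by (simp add: DERIV_def)
    have "filterlim uminus (at (0::real)) (at 0)"
      by (auto simp: filterlim_at intro!: tendsto_eq_intros eventually_neq_at_within)
    from filterlim_compose[OF 1 this]
    have "((\<lambda>t. (g' (- t) - g' 0) / - t) \<longlongrightarrow> g'' 0) (at 0)" .
    then have "((\<lambda>t. ((g' t - g' 0) / t + (g' (- t) - g' 0) / - t) / 2) \<longlongrightarrow> (g'' 0 + g'' 0) / 2) (at 0)"
      by (intro tendsto_divide[OF tendsto_add[OF 1] tendsto_const]) auto
    moreover have "((g' t - g' 0) / t + (g' (- t) - g' 0) / - t) / 2 = (g' t - g' (- t)) / (2 * t)" for t
      by (cases "t = 0") (auto simp: field_simps)
    ultimately have "((\<lambda>t. (g' t - g' (- t)) / (2 * t)) \<longlongrightarrow> (g'' 0 + g'' 0) / 2) (at 0)"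
      by (simp only:)
    then show "((\<lambda>t. (g' t - g' (- t)) / (2 * t)) \<longlongrightarrow> g'' 0) (at_right 0)"
      by (simp add: filterlim_at_split)
  qed (auto simp: eventually_at_filter)
qed

section \<open>Mollified weakly harmonic functions and comparison\<close>

lemma convolve_continuous:
  fixes \<eta> U :: "'a::euclidean_space \<Rightarrow> real"
  assumes cont: "continuous_on UNIV \<eta>" and supp: "\<And>z. norm z \<ge> R \<Longrightarrow> \<eta> z = 0"
    and U[measurable]: "U \<in> borel_measurable borel" and UC: "\<And>x. \<bar>U x\<bar> \<le> C"
  shows "continuous_on UNIV (convolve \<eta> U)"
  unfolding continuous_on_sequentially
proof (intro allI ballI impI)
  fix X :: "nat \<Rightarrow> 'a" and x assume "(\<forall>n. X n \<in> UNIV) \<and> X \<longlonglongrightarrow> x"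
  then have X: "X \<longlonglongrightarrow> x" by simp
  have [measurable]: "\<eta> \<in> borel_measurable borel" using cont by (rule borel_measurable_continuous_onI)
  obtain B where B: "\<And>x. \<bar>\<eta> x\<bar> \<le> B"
    using bounded_continuous_bounded_support[OF cont supp] by blast
  have X0: "(\<lambda>n. X n - x) \<longlonglongrightarrow> 0" using X by (simp add: LIM_zero)
  obtain M where M: "\<And>n. norm (X n - x) \<le> M"
    using convergent_imp_Bseq[OF convergentI[OF X0]] by (auto simp: Bseq_def)
  have "(\<lambda>n. convolve (\<lambda>z. \<eta> (z + (X n - x))) U x) \<longlonglongrightarrow> convolve \<eta> U x"
  proof (rule convolve_tendsto[OF _ _ U UC B])
    show "\<eta> (z + (X n - x)) = 0" if "R + M \<le> norm z" for n z
      using norm_triangle_ineq4[of "z + (X n - x)" "X n - x"] that M[of n] by (intro supp) simp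
    show "(\<lambda>n. \<eta> (z + (X n - x))) \<longlonglongrightarrow> \<eta> z" for z
      using continuous_on_tendsto_compose[OF cont tendsto_add[OF tendsto_const X0]] by simp
  qed measurable
  moreover have "convolve (\<lambda>z. \<eta> (z + (X n - x))) U x = convolve \<eta> U (X n)" for n
    unfolding convolve_def by (simp add: algebra_simps)
  ultimately show "(convolve \<eta> U \<circ> X) \<longlonglongrightarrow> convolve \<eta> U x" by (simp add: comp_def)
qed

lemma convolve_second_difference:
  fixes \<eta> U :: "'a::euclidean_space \<Rightarrow> real"
  assumes C2: "Ck 2 \<eta>" and supp: "\<And>z. norm z \<ge> R \<Longrightarrow> \<eta> z = 0"
    and b: "b \<in> Basis"
    and U[measurable]: "U \<in> borel_measurable borel" and UC: "\<And>x. \<bar>U x\<bar> \<le> C"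
  shows "((\<lambda>t. (convolve \<eta> U (x + t *\<^sub>R b) + convolve \<eta> U (x - t *\<^sub>R b) - 2 * convolve \<eta> U x) / t\<^sup>2)
    \<longlongrightarrow> convolve (partial b (partial b \<eta>)) U x) (at_right 0)"
proof -
  let ?p = "partial b \<eta>" and ?pp = "partial b (partial b \<eta>)"
  have diff: "\<forall>x. \<eta> differentiable (at x)" "\<forall>x. ?p differentiable (at x)"
    and contp: "continuous_on UNIV ?pp"
    using C2 b by (auto simp: numeral_2_eq_2)
  have cont: "continuous_on UNIV \<eta>" using Ck_continuous[OF C2] .
  have [measurable]: "\<eta> \<in> borel_measurable borel" "?pp \<in> borel_measurable borel"
    using cont contp by (auto intro: borel_measurable_continuous_onI)
  obtain B0 where B0: "\<And>x. \<bar>\<eta> x\<bar> \<le> B0"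
    using bounded_continuous_bounded_support[OF cont supp] by blast
  have suppp: "?p x = 0" if "R + 1 \<le> norm x" for x
    using that by (intro partial_zero_norm[of R] supp) auto
  have "?pp x = 0" if "R + 2 \<le> norm x" for x
    using that by (intro partial_zero_norm[of "R + 1"] suppp) auto
  then obtain B where B: "\<And>x. \<bar>?pp x\<bar> \<le> B"
    using bounded_continuous_bounded_support[OF contp] by blast
  have sd: "\<And>t. \<bar>\<eta> (z + t *\<^sub>R b) + \<eta> (z - t *\<^sub>R b) - 2 * \<eta> z\<bar> \<le> 2 * B * t\<^sup>2"
    and sl: "((\<lambda>t. (\<eta> (z + t *\<^sub>R b) + \<eta> (z - t *\<^sub>R b) - 2 * \<eta> z) / t\<^sup>2) \<longlongrightarrow> ?pp z) (at_right 0)" for z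
    using second_difference[of "\<lambda>t. \<eta> (z + t *\<^sub>R b)" "\<lambda>t. ?p (z + t *\<^sub>R b)" "\<lambda>t. ?pp (z + t *\<^sub>R b)",
        OF partial_along[OF diff(1)] partial_along[OF diff(2)]] B by auto
  show ?thesis
    unfolding tendsto_at_iff_sequentially
  proof (intro allI impI)
    fix X :: "nat \<Rightarrow> real" assume X: "\<forall>i. X i \<in> {0<..} - {0}" "X \<longlonglongrightarrow> 0"
    obtain M where M: "\<And>n. \<bar>X n\<bar> \<le> M"
      using convergent_imp_Bseq[OF convergentI[OF X(2)]] by (auto simp: Bseq_def)
    define q where "q n z = (\<eta> (z + X n *\<^sub>R b) + \<eta> (z - X n *\<^sub>R b) - 2 * \<eta> z) / (X n)\<^sup>2" for n z
    have "(\<lambda>n. convolve (q n) U x) \<longlonglongrightarrow> convolve ?pp U x"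
    proof (rule convolve_tendsto[OF _ _ U UC])
      show "q n \<in> borel_measurable borel" for n unfolding q_def by measurable
      show "\<bar>q n z\<bar> \<le> 2 * B" for n z
        using sd[of z "X n"] X(1)[rule_format, of n] by (simp add: q_def divide_le_eq)
      show "q n z = 0" if "R + M \<le> norm z" for n z
      proof -
        have "norm z \<le> norm (z + X n *\<^sub>R b) + \<bar>X n\<bar>" "norm z \<le> norm (z - X n *\<^sub>R b) + \<bar>X n\<bar>"
          using norm_triangle_ineq4[of "z + X n *\<^sub>R b" "X n *\<^sub>R b"]
            norm_triangle_ineq[of "z - X n *\<^sub>R b" "X n *\<^sub>R b"] b by simp_all
        then have "norm (z + X n *\<^sub>R b) \<ge> R" "norm (z - X n *\<^sub>R b) \<ge> R" "norm z \<ge> R"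
          using that M[of n] by linarith+
        then show ?thesis by (simp add: q_def supp)
      qed
      show "(\<lambda>n. q n z) \<longlonglongrightarrow> ?pp z" for z
        using sl[of z] X unfolding tendsto_at_iff_sequentially by (auto simp: q_def comp_def)
    qed measurable
    moreover have "convolve (q n) U x
        = (convolve \<eta> U (x + X n *\<^sub>R b) + convolve \<eta> U (x - X n *\<^sub>R b) - 2 * convolve \<eta> U x) / (X n)\<^sup>2" for n
    proof -
      have "convolve (q n) U x = (LINT y|lborel. (U y * \<eta> (x + X n *\<^sub>R b - y)
          + U y * \<eta> (x - X n *\<^sub>R b - y) - 2 * (U y * \<eta> (x - y))) / (X n)\<^sup>2)"
        unfolding convolve_def q_def by (intro Bochner_Integration.integral_cong refl) (simp add: algebra_simps)
      also have "\<dots> = (convolve \<eta> U (x + X n *\<^sub>R b) + convolve \<eta> U (x - X n *\<^sub>R b) - 2 * convolve \<eta> U x) / (X n)\<^sup>2"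
        unfolding convolve_def
        using convolve_integrable[where U=U and \<eta>=\<eta>, OF _ _ UC B0 supp]
        by simp
      finally show ?thesis .
    qed
    ultimately show "((\<lambda>t. (convolve \<eta> U (x + t *\<^sub>R b) + convolve \<eta> U (x - t *\<^sub>R b) - 2 * convolve \<eta> U x) / t\<^sup>2) \<circ> X)
        \<longlonglongrightarrow> convolve ?pp U x" by (simp add: comp_def)
  qed
qed

text \<open>Distributional harmonicity, with both derivatives on the test function. The integral is
  over the whole space, but \<open>laplacian \<phi>\<close> vanishes off \<open>\<Omega>\<close>, so
  the values of an extension outside do not enter.\<close>

definition weakly_harmonic :: "'a::euclidean_space set \<Rightarrow> ('a \<Rightarrow> real) \<Rightarrow> bool" where
  "weakly_harmonic \<Omega> W \<longleftrightarrow> (\<forall>\<phi>. test_function \<Omega> \<phi> \<longrightarrow> (LINT x|lborel. W x * laplacian \<phi> x) = 0)"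

lemma mollifier_test_function:
  assumes \<eta>: "mollifier d \<eta>" and "cball x d \<subseteq> \<Omega>"
  shows "test_function \<Omega> (\<lambda>y. \<eta> (x - y))"
proof -
  have "{y. \<eta> (x - y) \<noteq> 0} \<subseteq> cball x d"
    using mollifierD(4)[OF \<eta>] by (force simp: dist_norm)
  then have "closure {y. \<eta> (x - y) \<noteq> 0} \<subseteq> cball x d" by (simp add: closure_minimal)
  moreover then have "compact (closure {y. \<eta> (x - y) \<noteq> 0})"
    by (metis bounded_cball bounded_subset closed_closure compact_eq_bounded_closed)
  ultimately show ?thesis
    using assms Ck_reflect[OF mollifierD(1)[OF \<eta>]] unfolding test_function_def by blast
qed

text \<open>Once \<open>cball x d\<close> lies in \<open>\<Omega>\<close>, the kernel centred at
  \<open>x\<close> is an admissible test function, and the limits in the coordinate directions add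
  up to its pairing with \<open>W\<close> in the definition of weak harmonicity.\<close>

lemma mollified_second_difference:
  fixes W :: "'a::euclidean_space \<Rightarrow> real"
  assumes W: "W \<in> borel_measurable borel" "\<And>x. \<bar>W x\<bar> \<le> C" "weakly_harmonic \<Omega> W"
    and \<eta>: "mollifier d \<eta>" and x: "cball x d \<subseteq> \<Omega>"
  shows "((\<lambda>t. \<Sum>b\<in>Basis. (convolve \<eta> W (x + t *\<^sub>R b) + convolve \<eta> W (x - t *\<^sub>R b) - 2 * convolve \<eta> W x) / t\<^sup>2)
    \<longlongrightarrow> 0) (at_right 0)"
proof -
  note C2 = mollifierD(1)[OF \<eta>, of 2]
  have "integrable lborel (\<lambda>y. W y * partial b (partial b \<eta>) (x - y))" if b: "b \<in> Basis" for b
  proof -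
    have contp: "continuous_on UNIV (partial b (partial b \<eta>))"
      using C2 b by (auto simp: numeral_2_eq_2)
    have suppp: "partial b \<eta> x = 0" if "d + 1 \<le> norm x" for x
      using that by (intro partial_zero_norm[of d] mollifierD(4)[OF \<eta>]) auto
    have supp: "partial b (partial b \<eta>) x = 0" if "d + 2 \<le> norm x" for x
      using that by (intro partial_zero_norm[of "d + 1"] suppp) auto
    obtain B where B: "\<And>x. \<bar>partial b (partial b \<eta>) x\<bar> \<le> B"
      using bounded_continuous_bounded_support[OF contp supp] by blast
    show ?thesis
      by (rule convolve_integrable[OF borel_measurable_continuous_onI[OF contp] W(1,2) B supp])
  qed
  then have "(\<Sum>b\<in>Basis. convolve (partial b (partial b \<eta>)) W x) = (LINT y|lborel. W y * laplacian \<eta> (x - y))"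
    unfolding convolve_def laplacian_def sum_distrib_left by (subst Bochner_Integration.integral_sum) auto
  also have "\<dots> = (LINT y|lborel. W y * laplacian (\<lambda>y. \<eta> (x - y)) y)"
    by (simp add: laplacian_reflect[OF C2])
  also have "\<dots> = 0"
    using W(3) mollifier_test_function[OF \<eta> x] unfolding weakly_harmonic_def by blast
  finally have 0: "(\<Sum>b\<in>Basis. convolve (partial b (partial b \<eta>)) W x) = 0" .
  have "((\<lambda>t. \<Sum>b\<in>Basis. (convolve \<eta> W (x + t *\<^sub>R b) + convolve \<eta> W (x - t *\<^sub>R b) - 2 * convolve \<eta> W x) / t\<^sup>2)
    \<longlongrightarrow> (\<Sum>b\<in>Basis. convolve (partial b (partial b \<eta>)) W x)) (at_right 0)"
    by (intro tendsto_sum convolve_second_difference[OF C2 mollifierD(4)[OF \<eta>] _ W(1,2)])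
  then show ?thesis unfolding 0 .
qed

lemma uniformly_near_compact:
  fixes W :: "'a::euclidean_space \<Rightarrow> real"
  assumes "compact K" "continuous_on UNIV W" "e > 0"
  obtains d where "d > 0" "\<And>x y. x \<in> K \<Longrightarrow> norm (y - x) < d \<Longrightarrow> \<bar>W y - W x\<bar> < e"
proof -
  \<comment> \<open>The point \<open>y\<close> may leave \<open>K\<close>; uniform continuity is
    therefore taken on the compact unit neighbourhood of \<open>K\<close>, whence the
    \<open>min d 1\<close> below.\<close>
  define S where "S = {x + y | x y. x \<in> K \<and> y \<in> cball (0::'a) 1}"
  have "uniformly_continuous_on S W"
    unfolding S_def using assms
    by (intro compact_uniformly_continuous compact_sums) (auto intro: continuous_on_subset)
  then obtain d where d: "d > 0" "\<And>x y. x \<in> S \<Longrightarrow> y \<in> S \<Longrightarrow> dist y x < d \<Longrightarrow> dist (W y) (W x) < e"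
    using \<open>e > 0\<close> unfolding uniformly_continuous_on_def by blast
  show ?thesis
  proof (rule that[of "min d 1"])
    fix x y assume xy: "x \<in> K" "norm (y - x) < min d 1"
    have "x = x + 0" "y = x + (y - x)" by auto
    then have "x \<in> S" "y \<in> S" using xy unfolding S_def by (force, smt (verit) mem_Collect_eq mem_cball_0 min_less_iff_conj)
    then show "\<bar>W y - W x\<bar> < e" using d(2)[of x y] xy by (simp add: dist_norm)
  qed (use d in auto)
qed

text \<open>At an interior maximum of the mollified sum every symmetric second difference is at most
  0. The mollified \<open>W\<close> contributes 0 in the limit and \<open>\<beta>\<close>
  contributes \<open>L > 0\<close>, a contradiction. Mollifying finely enough keeps the maximum off
  the frontier.\<close>

lemma weak_maximum_principle:
  fixes W \<beta> :: "'a::euclidean_space \<Rightarrow> real"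
  assumes W: "continuous_on UNIV W" "\<And>x. \<bar>W x\<bar> \<le> C" "weakly_harmonic \<Omega> W"
    and \<Omega>: "open \<Omega>" and K: "compact K" "K \<subseteq> \<Omega>" and \<beta>: "continuous_on K \<beta>"
    and sub: "\<And>x. x \<in> interior K \<Longrightarrow> \<exists>L>0.
      ((\<lambda>t. \<Sum>b\<in>Basis. (\<beta> (x + t *\<^sub>R b) + \<beta> (x - t *\<^sub>R b) - 2 * \<beta> x) / t\<^sup>2) \<longlongrightarrow> L) (at_right 0)"
    and M: "\<And>z. z \<in> frontier K \<Longrightarrow> W z + \<beta> z \<le> M" and x: "x \<in> K"
  shows "W x + \<beta> x \<le> M"
proof (rule ccontr)
  assume neg: "\<not> ?thesis"
  \<comment> \<open>A third of the excess: after a mollification error of at most \<open>e\<close>,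
    the sum is at most \<open>M + e\<close> on the frontier but at least \<open>M + 2 * e\<close> at
    \<open>x\<close>.\<close>
  define e where "e = (W x + \<beta> x - M) / 3"
  have e: "e > 0" using neg by (simp add: e_def)
  obtain d1 where d1: "d1 > 0" "\<And>x y. x \<in> K \<Longrightarrow> norm (y - x) < d1 \<Longrightarrow> \<bar>W y - W x\<bar> < e"
    using uniformly_near_compact[OF K(1) W(1) e] by blast
  obtain d2 where d2: "d2 > 0" "(\<Union>x\<in>K. cball x d2) \<subseteq> \<Omega>"
    using compact_subset_open_imp_cball_epsilon_subset[OF K(1) \<Omega> K(2)] by blast
  \<comment> \<open>\<open>d1\<close> keeps the mollified function within \<open>e\<close> of
    \<open>W\<close> on \<open>K\<close>; \<open>d2\<close> keeps every kernel centred in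
    \<open>K\<close> supported inside \<open>\<Omega>\<close>.\<close>
  define d where "d = min d1 d2"
  have d: "d > 0" "cball z d \<subseteq> \<Omega>" if "z \<in> K" for z
    using d1(1) d2 that by (auto simp: d_def subset_iff)
  obtain \<eta> :: "'a \<Rightarrow> real" where \<eta>: "mollifier d \<eta>" using mollifier_exists d(1)[OF x] by blast
  have Wm: "W \<in> borel_measurable borel" using W(1) by (rule borel_measurable_continuous_onI)
  define w where "w = convolve \<eta> W"
  have near: "\<bar>w z - W z\<bar> \<le> e" if "z \<in> K" for z
    unfolding w_def by (rule convolve_average[OF \<eta> Wm]) (use d1(2)[OF that] in \<open>auto simp: d_def less_imp_le\<close>)
  have "continuous_on UNIV w"
    unfolding w_def by (rule convolve_continuous[OF mollifierD(5,4)[OF \<eta>] Wm W(2)])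
  then have "continuous_on K (\<lambda>z. w z + \<beta> z)"
    by (intro continuous_intros \<beta>) (auto intro: continuous_on_subset)
  then obtain m where m: "m \<in> K" "\<And>y. y \<in> K \<Longrightarrow> w y + \<beta> y \<le> w m + \<beta> m"
    using continuous_attains_sup[OF K(1)] x by blast
  have "m \<notin> frontier K"
  proof
    assume "m \<in> frontier K"
    have "3 * e = W x + \<beta> x - M" by (simp add: e_def)
    with M[OF \<open>m \<in> frontier K\<close>] show False
      using near[OF m(1)] near[OF x] m(2)[OF x] e by linarith
  qed
  then have mi: "m \<in> interior K" using m(1) closure_subset[of K] by (auto simp: frontier_def)
  obtain L where L: "L > 0"
    "((\<lambda>t. \<Sum>b\<in>Basis. (\<beta> (m + t *\<^sub>R b) + \<beta> (m - t *\<^sub>R b) - 2 * \<beta> m) / t\<^sup>2) \<longlongrightarrow> L) (at_right 0)"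
    using sub[OF mi] by blast
  obtain r where r: "r > 0" "ball m r \<subseteq> K" using mi by (auto simp: mem_interior)
  have "((\<lambda>t. (\<Sum>b\<in>Basis. (w (m + t *\<^sub>R b) + w (m - t *\<^sub>R b) - 2 * w m) / t\<^sup>2) +
      (\<Sum>b\<in>Basis. (\<beta> (m + t *\<^sub>R b) + \<beta> (m - t *\<^sub>R b) - 2 * \<beta> m) / t\<^sup>2)) \<longlongrightarrow> 0 + L) (at_right 0)"
    unfolding w_def
    by (intro tendsto_add L(2) mollified_second_difference[OF Wm W(2,3) \<eta> d(2)[OF m(1)]])
  moreover have "\<forall>\<^sub>F t in at_right 0. (\<Sum>b\<in>Basis. (w (m + t *\<^sub>R b) + w (m - t *\<^sub>R b) - 2 * w m) / t\<^sup>2) +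
      (\<Sum>b\<in>Basis. (\<beta> (m + t *\<^sub>R b) + \<beta> (m - t *\<^sub>R b) - 2 * \<beta> m) / t\<^sup>2) \<le> 0"
    using eventually_at_right_real[OF r(1)]
  proof eventually_elim
    fix t assume t: "t \<in> {0<..<r}"
    have "(w (m + t *\<^sub>R b) + w (m - t *\<^sub>R b) - 2 * w m) / t\<^sup>2
        + (\<beta> (m + t *\<^sub>R b) + \<beta> (m - t *\<^sub>R b) - 2 * \<beta> m) / t\<^sup>2 \<le> 0" if "b \<in> Basis" for b
    proof -
      have "m + t *\<^sub>R b \<in> ball m r" "m - t *\<^sub>R b \<in> ball m r"
        using t that by (auto simp: dist_norm)
      then have "w (m + t *\<^sub>R b) + \<beta> (m + t *\<^sub>R b) \<le> w m + \<beta> m" "w (m - t *\<^sub>R b) + \<beta> (m - t *\<^sub>R b) \<le> w m + \<beta> m"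
        using m(2) r(2) by blast+
      then show ?thesis
        unfolding add_divide_distrib[symmetric] by (intro divide_nonpos_nonneg) auto
    qed
    then show "(\<Sum>b\<in>Basis. (w (m + t *\<^sub>R b) + w (m - t *\<^sub>R b) - 2 * w m) / t\<^sup>2) +
      (\<Sum>b\<in>Basis. (\<beta> (m + t *\<^sub>R b) + \<beta> (m - t *\<^sub>R b) - 2 * \<beta> m) / t\<^sup>2) \<le> 0"
      unfolding sum.distrib[symmetric] by (rule sum_nonpos)
  qed
  ultimately have "0 + L \<le> 0" by (rule tendsto_upperbound) simp
  then show False using L(1) by simp
qed

section \<open>The strong maximum principle and the Hopf lemma\<close>

text \<open>The limit is the Laplacian of a Gaussian. Along each coordinate line \<open>G\<close> is
  the exponential of a quadratic polynomial, so the one-dimensional result applies, and the squared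
  coordinates of \<open>z - y\<close> sum to its squared norm.\<close>

lemma gauss_second_differences:
  fixes y z :: "'a::euclidean_space" and \<alpha> :: real
  defines "G \<equiv> (\<lambda>x. exp (- \<alpha> * (norm (x - y))\<^sup>2))"
  shows "((\<lambda>t. \<Sum>b\<in>Basis. (G (z + t *\<^sub>R b) + G (z - t *\<^sub>R b) - 2 * G z) / t\<^sup>2)
    \<longlongrightarrow> (4 * \<alpha>\<^sup>2 * (norm (z - y))\<^sup>2 - 2 * \<alpha> * DIM('a)) * G z) (at_right 0)"
proof -
  have lim: "((\<lambda>t. (G (z + t *\<^sub>R b) + G (z - t *\<^sub>R b) - 2 * G z) / t\<^sup>2)
    \<longlongrightarrow> (4 * \<alpha>\<^sup>2 * ((z - y) \<bullet> b)\<^sup>2 - 2 * \<alpha>) * G z) (at_right 0)" if b: "b \<in> Basis" for b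
  proof -
    define c where "c = (z - y) \<bullet> b"
    define g where "g t = exp (- \<alpha> * ((norm (z - y))\<^sup>2 + 2 * t * c + t\<^sup>2))" for t
    have "(norm (z + t *\<^sub>R b - y))\<^sup>2 = (norm (z - y))\<^sup>2 + 2 * t * c + t\<^sup>2" for t
    proof -
      have eq: "z + t *\<^sub>R b - y = (z - y) + t *\<^sub>R b" by simp
      have "(z - y) \<bullet> (t *\<^sub>R b) = t * c" "(norm (t *\<^sub>R b))\<^sup>2 = t\<^sup>2"
        using b by (simp_all add: c_def)
      with dot_norm[of "z - y" "t *\<^sub>R b"]
      have "t * c = ((norm (z - y + t *\<^sub>R b))\<^sup>2 - (norm (z - y))\<^sup>2 - t\<^sup>2) / 2" by metis
      then show ?thesis unfolding eq by simp
    qed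
    then have G: "G (z + t *\<^sub>R b) = g t" for t by (simp add: G_def g_def)
    have d: "(g has_real_derivative (- \<alpha> * (2 * c + 2 * t)) * g t) (at t)" for t
      unfolding g_def by (auto intro!: derivative_eq_intros simp: algebra_simps)
    have "((\<lambda>t. (- \<alpha> * (2 * c + 2 * t)) * g t) has_real_derivative
        ((\<alpha> * (2 * c + 2 * t))\<^sup>2 - 2 * \<alpha>) * g t) (at t)" for t
      by (auto intro!: derivative_eq_intros d simp: algebra_simps power2_eq_square)
    from second_difference(2)[OF d this]
    have "((\<lambda>t. (g t + g (- t) - 2 * g 0) / t\<^sup>2) \<longlongrightarrow> (4 * \<alpha>\<^sup>2 * c\<^sup>2 - 2 * \<alpha>) * g 0) (at_right 0)"
      by (simp add: power2_eq_square algebra_simps)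
    then show ?thesis
      using G[of "- t" for t] G[of 0] by (simp add: G c_def)
  qed
  have "(\<Sum>b\<in>Basis. ((z - y) \<bullet> b)\<^sup>2) = (norm (z - y))\<^sup>2"
    by (simp only: power2_norm_eq_inner) (subst euclidean_inner, simp add: power2_eq_square)
  then have "(\<Sum>b\<in>(Basis::'a set). (4 * \<alpha>\<^sup>2 * ((z - y) \<bullet> b)\<^sup>2 - 2 * \<alpha>) * G z)
      = (4 * \<alpha>\<^sup>2 * (norm (z - y))\<^sup>2 - 2 * \<alpha> * DIM('a)) * G z"
    by (simp add: sum_subtractf flip: sum_distrib_left sum_distrib_right)
  then show ?thesis by (intro tendsto_eq_rhs[OF tendsto_sum[OF lim]])
qed

text \<open>The barrier of the Hopf lemma: positive inside \<open>ball y R\<close>, zero on its boundary,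
  negative outside, and strictly subharmonic away from \<open>ball y (R / 2)\<close>.\<close>

definition barrier :: "'a::euclidean_space \<Rightarrow> real \<Rightarrow> 'a \<Rightarrow> real" where
  "barrier y R x = exp (- ((2 * DIM('a) + 1) / R\<^sup>2) * (norm (x - y))\<^sup>2)
     - exp (- ((2 * DIM('a) + 1) / R\<^sup>2) * R\<^sup>2)"

lemma barrier_continuous: "continuous_on S (barrier y R)"
  unfolding barrier_def by (intro continuous_intros)

text \<open>This explains the exponent \<open>\<alpha> = (2 * DIM('a) + 1) / R^2\<close>: for points
  at distance at least \<open>R / 2\<close> from \<open>y\<close>, the factor in the Gaussian
  Laplacian is at least \<open>\<alpha> * (\<alpha> * R^2) - 2 * \<alpha> * DIM('a) =
  \<alpha>\<close>, which is positive.\<close>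

lemma barrier_strictly_subharmonic:
  fixes y z :: "'a::euclidean_space"
  assumes "R > 0" "R / 2 \<le> norm (z - y)" "\<epsilon> > 0"
  shows "\<exists>L>0. ((\<lambda>t. \<Sum>b\<in>Basis. (\<epsilon> * barrier y R (z + t *\<^sub>R b) + \<epsilon> * barrier y R (z - t *\<^sub>R b)
      - 2 * (\<epsilon> * barrier y R z)) / t\<^sup>2) \<longlongrightarrow> L) (at_right 0)"
proof -
  define \<alpha> where "\<alpha> = (2 * DIM('a) + 1) / R\<^sup>2"
  define G where "G = (\<lambda>x. exp (- \<alpha> * (norm (x - y))\<^sup>2))"
  have \<alpha>: "\<alpha> > 0" "\<alpha> * R\<^sup>2 = 2 * DIM('a) + 1" using assms by (auto simp: \<alpha>_def field_simps)
  define L where "L = (4 * \<alpha>\<^sup>2 * (norm (z - y))\<^sup>2 - 2 * \<alpha> * DIM('a)) * G z"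
  have "(R / 2)\<^sup>2 \<le> (norm (z - y))\<^sup>2" using assms by (intro power_mono) auto
  then have "4 * \<alpha>\<^sup>2 * (R / 2)\<^sup>2 \<le> 4 * \<alpha>\<^sup>2 * (norm (z - y))\<^sup>2" by (intro mult_left_mono) auto
  moreover have "4 * \<alpha>\<^sup>2 * (R / 2)\<^sup>2 = \<alpha> * (\<alpha> * R\<^sup>2)" by (simp add: power2_eq_square)
  moreover have "\<alpha> * (\<alpha> * R\<^sup>2) = 2 * \<alpha> * DIM('a) + \<alpha>" unfolding \<alpha>(2) by (simp add: algebra_simps)
  ultimately have "4 * \<alpha>\<^sup>2 * (norm (z - y))\<^sup>2 - 2 * \<alpha> * DIM('a) \<ge> \<alpha>"
    by linarith
  then have "L > 0" using \<alpha> unfolding L_def G_def by (intro mult_pos_pos) auto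
  have eq: "\<epsilon> * barrier y R (z + t *\<^sub>R b) + \<epsilon> * barrier y R (z - t *\<^sub>R b) - 2 * (\<epsilon> * barrier y R z)
      = \<epsilon> * (G (z + t *\<^sub>R b) + G (z - t *\<^sub>R b) - 2 * G z)" for t b
    unfolding barrier_def G_def \<alpha>_def by (simp add: algebra_simps)
  have "((\<lambda>t. \<epsilon> * (\<Sum>b\<in>Basis. (G (z + t *\<^sub>R b) + G (z - t *\<^sub>R b) - 2 * G z) / t\<^sup>2)) \<longlongrightarrow> \<epsilon> * L) (at_right 0)"
    unfolding G_def L_def by (intro tendsto_mult_left gauss_second_differences)
  then have "((\<lambda>t. \<Sum>b\<in>Basis. (\<epsilon> * barrier y R (z + t *\<^sub>R b) + \<epsilon> * barrier y R (z - t *\<^sub>R b)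
      - 2 * (\<epsilon> * barrier y R z)) / t\<^sup>2) \<longlongrightarrow> \<epsilon> * L) (at_right 0)"
    unfolding eq by (simp add: sum_distrib_left)
  then show ?thesis using \<open>L > 0\<close> \<open>\<epsilon> > 0\<close> by (intro exI[of _ "\<epsilon> * L"]) auto
qed

lemma barrier_bounds:
  fixes x y :: "'a::euclidean_space"
  assumes "R > 0"
  shows "barrier y R x < 1" "norm (x - y) > R \<Longrightarrow> barrier y R x < 0" "norm (x - y) = R \<Longrightarrow> barrier y R x = 0"
proof -
  define \<alpha> where "\<alpha> = (2 * DIM('a) + 1) / R\<^sup>2"
  have \<alpha>: "\<alpha> > 0" using assms by (auto simp: \<alpha>_def)
  have "exp (- \<alpha> * (norm (x - y))\<^sup>2) \<le> 1" using \<alpha> by simp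
  then show "barrier y R x < 1" using exp_gt_zero[of "- \<alpha> * R\<^sup>2"] unfolding barrier_def \<alpha>_def by linarith
  show "barrier y R x < 0" if "norm (x - y) > R"
    using power_strict_mono[OF that, of 2] \<alpha> assms unfolding barrier_def \<alpha>_def[symmetric] by simp
qed (auto simp: barrier_def)

text \<open>If \<open>W\<close> touched \<open>M\<close> at \<open>x0\<close>, adding a small multiple of the barrier, which vanishes at \<open>x0\<close>,
  would make the sum less than \<open>M\<close> on a small sphere around \<open>x0\<close> but equal to \<open>M\<close> at its centre.\<close>

lemma no_interior_touching_point:
  fixes W :: "'a::euclidean_space \<Rightarrow> real"
  assumes W: "continuous_on UNIV W" "\<And>x. \<bar>W x\<bar> \<le> C" "weakly_harmonic \<Omega> W" and \<Omega>: "open \<Omega>"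
    and x0: "x0 \<in> \<Omega>" "norm (x0 - y) = R" "R > 0" and M: "\<And>x. x \<in> \<Omega> \<Longrightarrow> W x \<le> M"
    and less: "\<And>x. norm (x - y) \<le> R \<Longrightarrow> x \<noteq> x0 \<Longrightarrow> W x < M"
  shows "W x0 < M"
proof -
  obtain r where r: "r > 0" "cball x0 r \<subseteq> \<Omega>" using \<Omega> x0(1) open_contains_cball by metis
  \<comment> \<open>The bound \<open>R / 2\<close> keeps the small ball outside
    \<open>ball y (R / 2)\<close>, where the barrier is strictly subharmonic.\<close>
  define \<rho> where "\<rho> = min r (R / 2)"
  have \<rho>: "\<rho> > 0" "cball x0 \<rho> \<subseteq> \<Omega>" "\<rho> \<le> R / 2" using r x0(3) by (auto simp: \<rho>_def)
  have far: "norm (x - y) \<ge> R / 2" if "x \<in> cball x0 \<rho>" for x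
    using norm_triangle_ineq4[of "x - y" "x - x0"] that \<rho>(3) x0(2) by (simp add: dist_norm norm_minus_commute)
  \<comment> \<open>Part of the sphere lies in the closed ball around \<open>y\<close>; there
    \<open>W < M\<close> with a uniform gap by compactness, and the barrier stays below 1. On the
    rest \<open>W \<le> M\<close> and the barrier is negative.\<close>
  obtain \<epsilon> where \<epsilon>: "\<epsilon> > 0" "\<And>x. x \<in> sphere x0 \<rho> \<Longrightarrow> norm (x - y) \<le> R \<Longrightarrow> W x + \<epsilon> \<le> M"
  proof (cases "sphere x0 \<rho> \<inter> cball y R = {}")
    case True
    show ?thesis
    proof (rule that[of 1])
      fix x assume "x \<in> sphere x0 \<rho>" "norm (x - y) \<le> R"
      then have "x \<in> sphere x0 \<rho> \<inter> cball y R" by (simp add: dist_norm norm_minus_commute)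
      then show "W x + 1 \<le> M" using True by blast
    qed simp
  next
    case False
    have "compact (sphere x0 \<rho> \<inter> cball y R)" by auto
    then obtain m where m: "m \<in> sphere x0 \<rho> \<inter> cball y R" "\<And>x. x \<in> sphere x0 \<rho> \<inter> cball y R \<Longrightarrow> W x \<le> W m"
      using continuous_attains_sup[OF _ False continuous_on_subset[OF W(1) subset_UNIV]] by blast
    have "W m < M" using m(1) \<rho>(1) by (intro less) (auto simp: dist_norm norm_minus_commute)
    then show ?thesis
      using that[of "M - W m"] m(2) by (auto simp: dist_norm norm_minus_commute)
  qed
  have lt: "W z + \<epsilon> * barrier y R z < M" if z: "z \<in> sphere x0 \<rho>" for z
  proof (cases "norm (z - y) \<le> R")
    case True
    have "\<epsilon> * barrier y R z < \<epsilon> * 1"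
      by (rule mult_strict_left_mono[OF barrier_bounds(1)[OF x0(3)] \<epsilon>(1)])
    with \<epsilon>(2)[OF z True] show ?thesis by linarith
  next
    case False
    then have "\<epsilon> * barrier y R z < 0"
      using barrier_bounds(2)[OF x0(3), of z y] \<epsilon>(1) by (intro mult_pos_neg) auto
    moreover have "z \<in> \<Omega>" using z \<rho>(2) by auto
    ultimately show ?thesis using M by fastforce
  qed
  have "sphere x0 \<rho> \<noteq> {}" using \<rho>(1) by simp
  moreover have "continuous_on (sphere x0 \<rho>) (\<lambda>z. W z + \<epsilon> * barrier y R z)"
    by (intro continuous_intros barrier_continuous continuous_on_subset[OF W(1) subset_UNIV])
  \<comment> \<open>The weak principle yields a non-strict inequality; comparing with the maximum
    over the compact sphere, itself below \<open>M\<close>, makes it strict at the centre.\<close>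
  ultimately obtain m where m: "m \<in> sphere x0 \<rho>"
    "\<And>z. z \<in> sphere x0 \<rho> \<Longrightarrow> W z + \<epsilon> * barrier y R z \<le> W m + \<epsilon> * barrier y R m"
    using continuous_attains_sup[OF compact_sphere] by blast
  have "W x0 + \<epsilon> * barrier y R x0 \<le> W m + \<epsilon> * barrier y R m"
  proof (rule weak_maximum_principle[OF W \<Omega> compact_cball \<rho>(2)])
    show "continuous_on (cball x0 \<rho>) (\<lambda>z. \<epsilon> * barrier y R z)"
      by (intro continuous_intros barrier_continuous)
    show "z \<in> frontier (cball x0 \<rho>) \<Longrightarrow> W z + \<epsilon> * barrier y R z \<le> W m + \<epsilon> * barrier y R m" for z
      using m(2)[of z] by simp
    show "x0 \<in> cball x0 \<rho>" using \<rho>(1) by simp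
  qed (use far interior_subset in \<open>blast intro: barrier_strictly_subharmonic[OF x0(3) _ \<epsilon>(1)]\<close>)
  then show ?thesis using lt[OF m(1)] barrier_bounds(3)[OF x0(3,2)] by simp
qed

text \<open>By connectedness it is enough that the contact set \<open>?S\<close> is open. A
  non-contact point \<open>y\<close> close to a contact point would have a nearest contact point
  \<open>x0\<close>, touched by a ball free of other contact points, which the previous lemma
  excludes.\<close>

lemma strong_maximum_principle:
  fixes W :: "'a::euclidean_space \<Rightarrow> real"
  assumes W: "continuous_on UNIV W" "\<And>x. \<bar>W x\<bar> \<le> C" "weakly_harmonic \<Omega> W"
    and \<Omega>: "open \<Omega>" "connected \<Omega>" and M: "\<And>x. x \<in> \<Omega> \<Longrightarrow> W x \<le> M"
    and p: "p \<in> \<Omega>" "W p = M" and x: "x \<in> \<Omega>"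
  shows "W x = M"
proof -
  let ?S = "\<Omega> \<inter> {x. W x = M}" and ?T = "\<Omega> \<inter> {x. W x < M}"
  have openT: "open ?T"
    by (intro open_Int \<Omega>(1) open_Collect_less W(1) continuous_intros)
  have "open ?S"
    unfolding open_contains_ball
  proof
    fix p assume "p \<in> ?S"
    then have p: "p \<in> \<Omega>" "W p = M" by auto
    obtain r0 where r0: "r0 > 0" "cball p r0 \<subseteq> \<Omega>" using \<Omega>(1) p(1) open_contains_cball by metis
    define r where "r = r0 / 2"
    have r: "r > 0" "cball p (2 * r) \<subseteq> \<Omega>" using r0 by (auto simp: r_def)
    have "y \<in> ?S" if y: "y \<in> ball p r" for y
    proof (rule ccontr)
      assume "y \<notin> ?S"
      moreover have "y \<in> \<Omega>" using y r by auto
      ultimately have Wy: "W y < M" using M[of y] by auto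
      \<comment> \<open>Radius \<open>2 * r\<close> because the nearest contact point is less than
        \<open>r\<close> from \<open>y\<close> and \<open>y\<close> less than \<open>r\<close> from
        \<open>p\<close>: points closer to \<open>y\<close> than \<open>x0\<close> cannot escape
        this compact piece.\<close>
      let ?E = "cball p (2 * r) \<inter> {x. W x = M}"
      have "compact ?E"
        by (intro compact_Int_closed compact_cball closed_Collect_eq W(1) continuous_intros)
      moreover have "p \<in> ?E" using p r by auto
      ultimately obtain x0 where x0: "x0 \<in> ?E" "\<And>z. z \<in> ?E \<Longrightarrow> dist y x0 \<le> dist y z"
        using distance_attains_inf[of ?E y] compact_imp_closed by blast
      \<comment> \<open>The ball around \<open>y\<close> through \<open>x0\<close> may touch several
        contact points. The ball of half the radius, centred at the midpoint of \<open>y\<close> and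
        \<open>x0\<close>, meets the larger sphere at \<open>x0\<close> alone.\<close>
      define R where "R = dist y x0 / 2"
      define c where "c = y + (1/2) *\<^sub>R (x0 - y)"
      have "R > 0" using Wy x0(1) by (auto simp: R_def)
      have yx0: "dist y x0 < r" using x0(2)[OF \<open>p \<in> ?E\<close>] y by (simp add: dist_commute)
      have "W x0 < M"
      proof (rule no_interior_touching_point[OF W \<Omega>(1) _ _ \<open>R > 0\<close> M])
        show "x0 \<in> \<Omega>" using x0(1) r by auto
        have "x0 - c = (1/2) *\<^sub>R (x0 - y)" by (simp add: c_def algebra_simps flip: scaleR_add_left)
        then show "norm (x0 - c) = R" by (simp add: R_def dist_norm norm_minus_commute)
        fix x assume x: "norm (x - c) \<le> R" "x \<noteq> x0"
        have cy: "norm (c - y) = R" by (simp add: c_def R_def dist_norm norm_minus_commute)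
        have xy: "norm (x - y) \<le> 2 * R" using norm_triangle_ineq[of "x - c" "c - y"] x(1) cy by simp
        have "x \<notin> ?E"
        proof
          assume "x \<in> ?E"
          from x0(2)[OF this] have eq: "norm ((x - c) + (c - y)) = 2 * R"
            using xy by (simp add: R_def dist_norm norm_minus_commute)
          then have "norm (x - c) = R"
            using norm_triangle_ineq[of "x - c" "c - y"] x(1) cy by linarith
          \<comment> \<open>Equality in the triangle inequality makes \<open>x - c\<close> and
            \<open>c - y\<close> parallel; equal lengths then force \<open>x = x0\<close>.\<close>
          then have "norm (x - c) *\<^sub>R (c - y) = norm (c - y) *\<^sub>R (x - c)"
            using eq cy by (subst norm_triangle_eq[symmetric]) simp
          then have "c - y = x - c" using \<open>norm (x - c) = R\<close> cy \<open>R > 0\<close> by simp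
          then have "x = c + (c - y)" by simp
          also have "\<dots> = x0" by (simp add: c_def add.assoc flip: scaleR_add_left)
          finally show False using x(2) by simp
        qed
        moreover have "x \<in> cball p (2 * r)"
          using dist_triangle[of p x y] xy yx0 y by (simp add: R_def dist_norm norm_minus_commute)
        ultimately show "W x < M" using M[of x] r by auto
      qed
      then show False using x0(1) by simp
    qed
    then show "\<exists>e>0. ball p e \<subseteq> ?S" using r(1) by blast
  qed
  moreover have "\<Omega> \<subseteq> ?S \<union> ?T" using M by force
  moreover have "?S \<inter> ?T \<inter> \<Omega> = {}" by auto
  ultimately have "?T \<inter> \<Omega> = {}"
    using connectedD[OF \<Omega>(2), of ?S ?T] openT p by blast
  then show ?thesis using M[OF x] x by force
qed

text \<open>On the annulus between \<open>R / 2\<close> and \<open>R\<close>, \<open>W\<close> plus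
  a multiple of the barrier stays below \<open>W x0\<close>. The barrier decreases outward with
  nonzero slope at radius \<open>R\<close>, which bounds the inward difference quotients of
  \<open>W\<close> below by a positive constant.\<close>

lemma Hopf_lemma:
  fixes W :: "'a::euclidean_space \<Rightarrow> real"
  assumes W: "continuous_on UNIV W" "\<And>x. \<bar>W x\<bar> \<le> C" "weakly_harmonic \<Omega> W" and \<Omega>: "open \<Omega>"
    and ball: "ball (x0 - R *\<^sub>R \<nu>) R \<subseteq> \<Omega>" "R > 0" "norm \<nu> = 1"
    and less: "\<And>x. x \<in> \<Omega> \<Longrightarrow> W x < W x0"
  shows "\<not> ((\<lambda>t. (W x0 - W (x0 - t *\<^sub>R \<nu>)) / t) \<longlongrightarrow> 0) (at_right 0)"
proof
  assume lim: "((\<lambda>t. (W x0 - W (x0 - t *\<^sub>R \<nu>)) / t) \<longlongrightarrow> 0) (at_right 0)"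
  define y where "y = x0 - R *\<^sub>R \<nu>"
  define M where "M = W x0"
  have in\<Omega>: "x \<in> \<Omega>" if "norm (x - y) < R" for x
    using ball(1) that by (auto simp: y_def dist_norm norm_minus_commute)
  have "cball y (R / 2) \<noteq> {}" using ball(2) by simp
  then obtain m where m: "m \<in> cball y (R / 2)" "\<And>x. x \<in> cball y (R / 2) \<Longrightarrow> W x \<le> W m"
    using continuous_attains_sup[OF compact_cball _ continuous_on_subset[OF W(1) subset_UNIV]] by blast
  \<comment> \<open>The gap between \<open>M\<close> and the maximum on the inner closed ball: since
    the barrier is less than 1, adding \<open>\<epsilon>\<close> times it does not exceed
    \<open>M\<close> on the inner sphere.\<close>
  define \<epsilon> where "\<epsilon> = M - W m"
  have \<epsilon>: "\<epsilon> > 0"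
    using m(1) ball(2) less[OF in\<Omega>[of m]] by (auto simp: \<epsilon>_def M_def dist_norm norm_minus_commute)
  define \<alpha> where "\<alpha> = (2 * DIM('a) + 1) / R\<^sup>2"
  have \<alpha>: "\<alpha> > 0" using ball(2) by (auto simp: \<alpha>_def)
  define c where "c s = exp (- \<alpha> * s\<^sup>2) - exp (- \<alpha> * R\<^sup>2)" for s
  have bc: "barrier y R x = c (norm (x - y))" for x by (simp add: barrier_def c_def \<alpha>_def)
  have claim: "W x + \<epsilon> * barrier y R x \<le> M" if x: "R / 2 \<le> norm (x - y)" "norm (x - y) < R" for x
  proof -
    \<comment> \<open>The open ball lies in \<open>\<Omega>\<close>, but its boundary sphere
      contains \<open>x0\<close> and may leave \<open>\<Omega>\<close>. The comparison is made on
      compact annuli of outer radius \<open>R' < R\<close>, and \<open>R'\<close> tends to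
      \<open>R\<close> afterwards.\<close>
    have le: "W x + \<epsilon> * barrier y R x \<le> M + \<epsilon> * c R'" if R': "norm (x - y) < R'" "R' < R" for R'
    proof -
      define K where "K = cball y R' - ball y (R / 2)"
      have K: "z \<in> K \<longleftrightarrow> R / 2 \<le> norm (z - y) \<and> norm (z - y) \<le> R'" for z
        by (auto simp: K_def dist_norm norm_minus_commute)
      have "compact K" unfolding K_def by (intro compact_diff compact_cball open_ball)
      have cpos: "c R' \<ge> 0"
      proof -
        have "0 \<le> R'" using R' norm_ge_zero[of "x - y"] by linarith
        then have "R'\<^sup>2 \<le> R\<^sup>2" using R' by (intro power_mono) auto
        then show ?thesis using \<alpha> by (simp add: c_def)
      qed
      show ?thesis
      proof (rule weak_maximum_principle[OF W \<Omega> \<open>compact K\<close>])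
        show "K \<subseteq> \<Omega>" using K in\<Omega> R' by force
        show "continuous_on K (\<lambda>x. \<epsilon> * barrier y R x)"
          by (intro continuous_intros barrier_continuous)
        show "x \<in> K" using K x R' by auto
        fix z assume z: "z \<in> frontier K"
        then have zK: "z \<in> K" using compact_imp_closed[OF \<open>compact K\<close>] frontier_subset_closed by blast
        have "z \<notin> ball y R' - cball y (R / 2)"
        proof
          assume "z \<in> ball y R' - cball y (R / 2)"
          moreover have "ball y R' - cball y (R / 2) \<subseteq> K" by (auto simp: K_def)
          ultimately have "z \<in> interior K" by (metis interiorI open_Diff open_ball closed_cball)
          then show False using z by (simp add: frontier_def)
        qed
        then consider "norm (z - y) = R'" | "norm (z - y) = R / 2"
          using zK K by (fastforce simp: dist_norm norm_minus_commute)
        then show "W z + \<epsilon> * barrier y R z \<le> M + \<epsilon> * c R'"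
        proof cases
          case 1
          then show ?thesis using less[OF in\<Omega>[of z]] R' by (simp add: bc M_def)
        next
          case 2
          have "W z \<le> W m" using 2 by (intro m(2)) (simp add: dist_norm norm_minus_commute)
          moreover have "\<epsilon> * barrier y R z \<le> \<epsilon>"
            using barrier_bounds(1)[OF ball(2), of y z] \<epsilon> by simp
          moreover have "\<epsilon> * c R' \<ge> 0" using cpos \<epsilon> by simp
          ultimately show ?thesis by (simp add: \<epsilon>_def)
        qed
      next
        fix z assume "z \<in> interior K"
        then have "R / 2 \<le> norm (z - y)" using K interior_subset by blast
        from barrier_strictly_subharmonic[OF ball(2) this \<epsilon>]
        show "\<exists>L>0. ((\<lambda>t. \<Sum>b\<in>Basis. (\<epsilon> * barrier y R (z + t *\<^sub>R b) + \<epsilon> * barrier y R (z - t *\<^sub>R b)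
          - 2 * (\<epsilon> * barrier y R z)) / t\<^sup>2) \<longlongrightarrow> L) (at_right 0)" .
      qed
    qed
    have "((\<lambda>R'. M + \<epsilon> * c R') \<longlongrightarrow> M + \<epsilon> * c R) (at_left R)"
      unfolding c_def by (intro tendsto_intros)
    moreover have "\<forall>\<^sub>F R' in at_left R. W x + \<epsilon> * barrier y R x \<le> M + \<epsilon> * c R'"
      using eventually_at_left_real[OF x(2)] by eventually_elim (use le in auto)
    ultimately have "W x + \<epsilon> * barrier y R x \<le> M + \<epsilon> * c R"
      by (rule tendsto_lowerbound) simp
    then show ?thesis by (simp add: c_def)
  qed
  have dc: "(c has_real_derivative (- 2 * \<alpha> * R * exp (- \<alpha> * R\<^sup>2))) (at R)"
    unfolding c_def by (auto intro!: derivative_eq_intros)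
  have "((\<lambda>t. (c (R + - t) - c R) / - t) \<longlongrightarrow> - 2 * \<alpha> * R * exp (- \<alpha> * R\<^sup>2)) (at 0)"
  proof (rule filterlim_compose[OF dc[unfolded DERIV_def]])
    show "filterlim uminus (at (0::real)) (at 0)"
      by (auto simp: filterlim_at intro!: tendsto_eq_intros eventually_neq_at_within)
  qed
  then have "((\<lambda>t. (c (R + - t) - c R) / - t) \<longlongrightarrow> - 2 * \<alpha> * R * exp (- \<alpha> * R\<^sup>2)) (at_right 0)"
    by (simp add: filterlim_at_split)
  note lim1 = tendsto_mult[OF tendsto_const[of "- \<epsilon>"] this]
  \<comment> \<open>Since \<open>c R = 0\<close>, this quotient is a multiple of the difference
    quotient of the radial profile \<open>c\<close> at \<open>R\<close>, taken from inside.\<close>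
  have lim2: "((\<lambda>t. \<epsilon> * c (R - t) / t) \<longlongrightarrow> \<epsilon> * (2 * \<alpha> * R * exp (- \<alpha> * R\<^sup>2))) (at_right 0)"
  proof (rule tendsto_eq_rhs[OF Lim_transform_eventually[OF lim1]])
    show "\<forall>\<^sub>F t in at_right 0. - \<epsilon> * ((c (R + - t) - c R) / - t) = \<epsilon> * c (R - t) / t"
      by (simp add: c_def)
  qed simp
  have "\<forall>\<^sub>F t in at_right 0. \<epsilon> * c (R - t) / t \<le> (W x0 - W (x0 - t *\<^sub>R \<nu>)) / t"
    using eventually_at_right_real[OF half_gt_zero[OF ball(2)]]
  proof eventually_elim
    fix t assume t: "t \<in> {0<..<R / 2}"
    have "x0 - t *\<^sub>R \<nu> - y = (R - t) *\<^sub>R \<nu>" by (simp add: y_def algebra_simps)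
    then have n: "norm (x0 - t *\<^sub>R \<nu> - y) = R - t" using t ball(3) by simp
    then have "W (x0 - t *\<^sub>R \<nu>) + \<epsilon> * c (R - t) \<le> M"
      using claim[of "x0 - t *\<^sub>R \<nu>"] t by (simp add: bc)
    then show "\<epsilon> * c (R - t) / t \<le> (W x0 - W (x0 - t *\<^sub>R \<nu>)) / t"
      using t by (intro divide_right_mono) (auto simp: M_def)
  qed
  with lim2 lim have "\<epsilon> * (2 * \<alpha> * R * exp (- \<alpha> * R\<^sup>2)) \<le> 0"
    by (intro tendsto_le[of "at_right 0"]) auto
  moreover have "\<epsilon> * (2 * \<alpha> * R * exp (- \<alpha> * R\<^sup>2)) > 0" using \<epsilon> \<alpha> ball(2) by simp
  ultimately show False by linarith
qed

section \<open>The Neumann problem\<close>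

text \<open>The normal is a choice, so the argument uses whichever chart was selected. The defining
  function \<open>y \<bullet> e - h (hyperplane_proj e y)\<close> has Lipschitz gradient, so it is
  at most linear plus quadratic around \<open>x\<close>; in a small enough tangent ball the negative
  linear term wins.\<close>

lemma interior_ball:
  fixes \<Omega> :: "'a::euclidean_space set"
  assumes bdry: "C11_boundary \<Omega>" and x: "x \<in> frontier \<Omega>"
  shows "norm (outward_normal \<Omega> x) = 1"
    and "\<exists>R>0. ball (x - R *\<^sub>R outward_normal \<Omega> x) R \<subseteq> \<Omega>"
proof -
  let ?P = "hyperplane_proj"
  have deriv: "GDERIV (\<lambda>y. y \<bullet> e - h (?P e y)) x :> (e - ?P e (G (?P e x)))"
    if "\<And>y. GDERIV h y :> G y" for h G and e :: 'a
  proof -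
    have P: "(?P e has_derivative ?P e) (at x)"
      unfolding hyperplane_proj_def by (auto intro!: derivative_eq_intros)
    have "((\<lambda>y. y \<bullet> e - h (?P e y)) has_derivative (\<lambda>v. v \<bullet> e - ?P e v \<bullet> G (?P e x))) (at x)"
      using that[of "?P e x"] unfolding gderiv_def
      by (intro derivative_intros has_derivative_compose[OF P])
    moreover have "v \<bullet> e - ?P e v \<bullet> G (?P e x) = v \<bullet> (e - ?P e (G (?P e x)))" for v
      by (simp add: hyperplane_proj_def inner_diff_left inner_diff_right inner_commute)
    ultimately show ?thesis by (simp add: gderiv_def)
  qed
  have "\<exists>\<nu> e r h D. boundary_chart \<Omega> x e r h \<and> (GDERIV (\<lambda>y. y \<bullet> e - h (?P e y)) x :> D) \<and> \<nu> = sgn D"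
  proof -
    obtain e r h where c: "boundary_chart \<Omega> x e r h" using bdry x unfolding C11_boundary_def by blast
    then obtain G where "\<And>y. GDERIV h y :> G y" unfolding boundary_chart_def C11_def by blast
    from deriv[OF this] c show ?thesis by blast
  qed
  from someI_ex[OF this, folded outward_normal_def] obtain e r h D where
    chart: "boundary_chart \<Omega> x e r h" and D: "GDERIV (\<lambda>y. y \<bullet> e - h (?P e y)) x :> D"
    and \<nu>: "outward_normal \<Omega> x = sgn D"
    by blast
  have e: "norm e = 1" and r: "r > 0"
    and \<Omega>: "\<And>y. y \<in> ball x r \<Longrightarrow> y \<in> \<Omega> \<longleftrightarrow> y \<bullet> e < h (?P e y)"
    using chart unfolding boundary_chart_def by blast+
  obtain G L where G: "\<And>y. GDERIV h y :> G y" and L: "L-lipschitz_on UNIV G"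
    using chart unfolding boundary_chart_def C11_def by blast
  have "(\<lambda>v. v \<bullet> D) = (\<lambda>v. v \<bullet> (e - ?P e (G (?P e x))))"
    using D deriv[OF G] unfolding gderiv_def by (rule has_derivative_unique)
  then have D_eq: "D = e - ?P e (G (?P e x))"
    by (metis inner_commute vector_eq_rdot)
  have ee: "e \<bullet> e = 1" using e by (simp add: norm_eq_1)
  \<comment> \<open>The part of \<open>D\<close> coming from \<open>h\<close> is orthogonal to
    \<open>e\<close>, so the gradient cannot vanish and \<open>sgn D\<close> is a unit
    vector.\<close>
  have "D \<bullet> e = 1"
    unfolding D_eq hyperplane_proj_def by (simp add: inner_diff_left ee)
  then have "D \<noteq> 0" by auto
  then show n1: "norm (outward_normal \<Omega> x) = 1" by (simp add: \<nu> norm_sgn)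
  define \<psi> where "\<psi> y = y \<bullet> e - h (?P e y)" for y
  \<comment> \<open>A boundary point is a limit of points of \<open>\<Omega>\<close>, where the
    defining function is negative; continuity rules out a positive value.\<close>
  have "\<psi> x \<le> 0"
  proof (rule ccontr)
    assume "\<not> \<psi> x \<le> 0"
    have "isCont \<psi> x"
      using D has_derivative_continuous unfolding \<psi>_def gderiv_def by blast
    then have "\<forall>\<^sub>F y in nhds x. 0 < \<psi> y"
      using \<open>\<not> \<psi> x \<le> 0\<close> by (intro order_tendstoD(1)[of \<psi> "\<psi> x"]) (auto simp: isCont_def tendsto_at_iff_tendsto_nhds)
    then obtain S where S: "open S" "x \<in> S" "\<And>y. y \<in> S \<Longrightarrow> 0 < \<psi> y"
      unfolding eventually_nhds by blast
    have "x \<in> closure \<Omega>" using x by (simp add: frontier_def)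
    moreover have "open (S \<inter> ball x r)" "x \<in> S \<inter> ball x r" using S r by auto
    ultimately obtain y where "y \<in> \<Omega>" "y \<in> S \<inter> ball x r"
      unfolding closure_iff_nhds_not_empty by blast
    then show False using \<Omega>[of y] S(3)[of y] by (auto simp: \<psi>_def)
  qed
  have P_le: "norm (?P e v) \<le> norm v" for v
  proof -
    have "?P e v \<bullet> ?P e v = v \<bullet> v - (v \<bullet> e)\<^sup>2"
      unfolding hyperplane_proj_def inner_diff_left inner_diff_right inner_scaleR_left inner_scaleR_right
        inner_commute[of e v] ee power2_eq_square by simp
    then have "(norm (?P e v))\<^sup>2 = (norm v)\<^sup>2 - (v \<bullet> e)\<^sup>2" by (simp only: power2_norm_eq_inner)
    then have "(norm (?P e v))\<^sup>2 \<le> (norm v)\<^sup>2" by simp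
    then show ?thesis by (simp add: power2_le_iff_abs_le)
  qed
  have L0: "L \<ge> 0" using L by (rule lipschitz_on_nonneg)
  \<comment> \<open>The mean value theorem on the segment between the projections leaves a gradient
    difference of at most \<open>L * norm (q - p)\<close>, and projecting does not increase
    lengths.\<close>
  have est: "\<psi> y \<le> \<psi> x + (y - x) \<bullet> D + L * (norm (y - x))\<^sup>2" for y
  proof -
    define p q where "p = ?P e x" and "q = ?P e y"
    have "((\<lambda>t. h (p + t *\<^sub>R (q - p))) has_real_derivative (q - p) \<bullet> G (p + t *\<^sub>R (q - p))) (at t)" for t
    proof -
      have "((\<lambda>t. p + t *\<^sub>R (q - p)) has_derivative (\<lambda>t. t *\<^sub>R (q - p))) (at t)"
        by (auto intro!: derivative_eq_intros)
      from has_derivative_compose[OF this G[unfolded gderiv_def]]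
      show ?thesis by (simp add: has_field_derivative_def mult_commute_abs)
    qed
    then obtain t where t: "0 < t" "t < 1" "h q - h p = (q - p) \<bullet> G (p + t *\<^sub>R (q - p))"
      using MVT2[of 0 1 "\<lambda>t. h (p + t *\<^sub>R (q - p))" "\<lambda>t. (q - p) \<bullet> G (p + t *\<^sub>R (q - p))"] by auto
    have qp: "q - p = ?P e (y - x)" by (simp add: p_def q_def hyperplane_proj_def algebra_simps)
    have "(q - p) \<bullet> (G p - G (p + t *\<^sub>R (q - p))) \<le> norm (q - p) * norm (G p - G (p + t *\<^sub>R (q - p)))"
      by (rule norm_cauchy_schwarz)
    also have "\<dots> \<le> norm (q - p) * (L * (t * norm (q - p)))"
      using lipschitz_onD[OF L, of p "p + t *\<^sub>R (q - p)"] t(1) by (intro mult_left_mono) (auto simp: dist_norm)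
    also have "\<dots> \<le> norm (q - p) * (L * (1 * norm (q - p)))"
      using t L0 by (intro mult_left_mono mult_right_mono) auto
    also have "\<dots> = L * (norm (q - p))\<^sup>2" by (simp add: power2_eq_square)
    also have "\<dots> \<le> L * (norm (y - x))\<^sup>2"
      unfolding qp using L0 P_le by (intro mult_left_mono power_mono) auto
    finally have "(q - p) \<bullet> G p - (h q - h p) \<le> L * (norm (y - x))\<^sup>2"
      unfolding t(3) by (simp add: inner_diff_right)
    moreover have "(y - x) \<bullet> D = (y - x) \<bullet> e - (q - p) \<bullet> G p"
      unfolding D_eq qp p_def[symmetric]
      by (simp add: hyperplane_proj_def inner_diff_left inner_diff_right inner_commute algebra_simps)
    ultimately show ?thesis unfolding \<psi>_def p_def[symmetric] q_def[symmetric]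
      by (simp add: inner_diff_left)
  qed
  define \<nu>' where "\<nu>' = sgn D"
  \<comment> \<open>Points of the tangent ball are within \<open>2 * R\<close> of \<open>x\<close>,
    so \<open>r / 2\<close> keeps them in the chart. The other bound gives
    \<open>2 * R * L \<le> norm D\<close>; \<open>L + 1\<close> avoids a zero denominator.\<close>
  define R where "R = min (r / 2) (norm D / (2 * (L + 1)))"
  have R: "R > 0" "R \<le> r / 2" "R \<le> norm D / (2 * (L + 1))"
    unfolding R_def using r \<open>D \<noteq> 0\<close> L0 by (simp, intro min.cobounded1, intro min.cobounded2)
  have "ball (x - R *\<^sub>R \<nu>') R \<subseteq> \<Omega>"
  proof
    fix y assume "y \<in> ball (x - R *\<^sub>R \<nu>') R"
    then have y: "norm ((y - x) + R *\<^sub>R \<nu>') < R" by (simp add: dist_norm norm_minus_commute algebra_simps)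
    have n1': "norm \<nu>' = 1" using n1 \<nu> by (simp add: \<nu>'_def)
    have "norm (y - x) < 2 * R"
      using norm_triangle_ineq4[of "(y - x) + R *\<^sub>R \<nu>'" "R *\<^sub>R \<nu>'"] y n1' R(1) by simp
    then have yr: "y \<in> ball x r" using R(2) by (simp add: dist_norm norm_minus_commute)
    have "(norm ((y - x) + R *\<^sub>R \<nu>'))\<^sup>2 < R\<^sup>2" using y R(1) by (intro power_strict_mono) auto
    moreover have "(norm (R *\<^sub>R \<nu>'))\<^sup>2 = R\<^sup>2" using n1' by simp
    \<comment> \<open>Expanding the square turns membership in the tangent ball into a negative
      upper bound, quadratic in \<open>norm (y - x)\<close>, on the linear term.\<close>
    ultimately have "(y - x) \<bullet> (R *\<^sub>R \<nu>') < - ((norm (y - x))\<^sup>2) / 2"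
      using dot_norm[of "y - x" "R *\<^sub>R \<nu>'"] by simp
    then have "R * ((y - x) \<bullet> \<nu>') < - ((norm (y - x))\<^sup>2) / 2" by simp
    moreover have "(y - x) \<bullet> D = norm D * ((y - x) \<bullet> \<nu>')"
      using \<open>D \<noteq> 0\<close> by (simp add: \<nu>'_def sgn_div_norm)
    ultimately have "R * ((y - x) \<bullet> D) < norm D * (- ((norm (y - x))\<^sup>2) / 2)"
      using \<open>D \<noteq> 0\<close> by (metis mult.left_commute mult_strict_left_mono zero_less_norm_iff)
    moreover have "R * (L * (norm (y - x))\<^sup>2) \<le> norm D * ((norm (y - x))\<^sup>2 / 2)"
    proof -
      have "R * (2 * (L + 1)) \<le> norm D" using R(3) L0 by (simp add: pos_le_divide_eq)
      then have "2 * (R * L) \<le> norm D" using R(1) by (simp add: algebra_simps)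
      from mult_right_mono[OF this, of "(norm (y - x))\<^sup>2"] show ?thesis by (simp add: algebra_simps)
    qed
    ultimately have "R * ((y - x) \<bullet> D + L * (norm (y - x))\<^sup>2) < 0" by (simp add: algebra_simps)
    then have "(y - x) \<bullet> D + L * (norm (y - x))\<^sup>2 < 0" using R(1) by (simp add: mult_less_0_iff)
    then have "\<psi> y < 0" using est[of y] \<open>\<psi> x \<le> 0\<close> by linarith
    then show "y \<in> \<Omega>" using \<Omega>[OF yr] by (simp add: \<psi>_def)
  qed
  then show "\<exists>R>0. ball (x - R *\<^sub>R outward_normal \<Omega> x) R \<subseteq> \<Omega>"
    using R(1) unfolding \<nu> \<nu>'_def by blast
qed

lemma inward_points:
  assumes "ball (x - R *\<^sub>R \<nu>) R \<subseteq> \<Omega>" "R > 0" "norm \<nu> = 1"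
  shows "\<forall>\<^sub>F t in at_right 0. x - t *\<^sub>R \<nu> \<in> \<Omega>"
  using eventually_at_right_real[OF \<open>R > 0\<close>]
proof eventually_elim
  fix t assume t: "t \<in> {0<..<R}"
  have "(x - R *\<^sub>R \<nu>) - (x - t *\<^sub>R \<nu>) = (t - R) *\<^sub>R \<nu>" by (simp add: algebra_simps)
  then have "x - t *\<^sub>R \<nu> \<in> ball (x - R *\<^sub>R \<nu>) R" using t assms(3) by (simp add: dist_norm)
  then show "x - t *\<^sub>R \<nu> \<in> \<Omega>" using assms(1) by blast
qed

lemma homogeneous_Neumann_constant:
  fixes W :: "'a::euclidean_space \<Rightarrow> real"
  assumes W: "continuous_on UNIV W" "\<And>x. \<bar>W x\<bar> \<le> C" "weakly_harmonic \<Omega> W"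
    and \<Omega>: "bounded_domain \<Omega>" "C11_boundary \<Omega>"
    and nd: "\<And>x. x \<in> frontier \<Omega> \<Longrightarrow> has_outward_normal_derivative \<Omega> W x 0"
  shows "\<exists>c. \<forall>x\<in>closure \<Omega>. W x = c"
proof -
  have o: "open \<Omega>" "connected \<Omega>" "\<Omega> \<noteq> {}" "bounded \<Omega>" using \<Omega>(1) unfolding bounded_domain_def by auto
  then have "compact (closure \<Omega>)" "closure \<Omega> \<noteq> {}" by (auto simp: compact_closure)
  then obtain x0 where x0: "x0 \<in> closure \<Omega>" "\<And>x. x \<in> closure \<Omega> \<Longrightarrow> W x \<le> W x0"
    using continuous_attains_sup[OF _ _ continuous_on_subset[OF W(1) subset_UNIV]] by metis
  have M: "W x \<le> W x0" if "x \<in> \<Omega>" for x using that x0(2) closure_subset by blast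
  have "\<exists>p\<in>\<Omega>. W p = W x0"
  proof (rule ccontr)
    assume "\<not> ?thesis"
    then have less: "W x < W x0" if "x \<in> \<Omega>" for x using M[OF that] that by fastforce
    have "x0 \<notin> \<Omega>" using less by blast
    then have fr: "x0 \<in> frontier \<Omega>" using x0(1) o(1) by (simp add: frontier_def interior_open)
    obtain R where R: "R > 0" "ball (x0 - R *\<^sub>R outward_normal \<Omega> x0) R \<subseteq> \<Omega>"
      using interior_ball(2)[OF \<Omega>(2) fr] by blast
    from Hopf_lemma[OF W o(1) R(2,1) interior_ball(1)[OF \<Omega>(2) fr] less] nd[OF fr]
    show False unfolding has_outward_normal_derivative_def by blast
  qed
  then obtain p where p: "p \<in> \<Omega>" "W p = W x0" by blast
  have "W x = W x0" if "x \<in> \<Omega>" for x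
    by (rule strong_maximum_principle[OF W o(1,2) M p that])
  then have "W x = W x0" if "x \<in> closure \<Omega>" for x
    using continuous_constant_on_closure[OF continuous_on_subset[OF W(1) subset_UNIV]] that by blast
  then show ?thesis by blast
qed

section \<open>From weak derivatives on the domain to integrals over the whole space\<close>

text \<open>Weak derivatives are Lebesgue measurable and integrable on compact subsets of
  \<open>\<Omega>\<close>, whereas the convolution lemmas want an integrable Borel function on the
  whole space. Cutting off by \<open>K\<close> and taking a Borel representative gives one
  \<open>H\<close> for all \<open>\<zeta>\<close> supported in \<open>K\<close>.\<close>

lemma locally_integrable_pairing:
  fixes v :: "'a::euclidean_space \<Rightarrow> real"
  assumes v: "locally_integrable_on \<Omega> v" and K: "compact K" "K \<subseteq> \<Omega>"
  obtains H where "integrable lborel H"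
    "\<And>\<zeta>. continuous_on UNIV \<zeta> \<Longrightarrow> (\<And>x. x \<notin> K \<Longrightarrow> \<zeta> x = 0) \<Longrightarrow>
      (LINT x:\<Omega>|lebesgue. v x * \<zeta> x) = (LINT x|lborel. H x * \<zeta> x)"
proof -
  define g where "g x = indicator K x * v x" for x
  have g: "integrable lebesgue g"
    using v K unfolding locally_integrable_on_def set_integrable_def g_def by simp
  then obtain H where H[measurable]: "H \<in> borel_measurable lborel" and "AE x in lborel. g x = H x"
    using completion_ex_borel_measurable_real[OF borel_measurable_integrable] by blast
  then have ae: "AE x in lebesgue. g x = H x" by (intro AE_completion)
  have Hm: "H \<in> borel_measurable lebesgue" using H by (rule measurable_completion)
  have "integrable lebesgue H"
    using integrable_cong_AE[OF borel_measurable_integrable[OF g] Hm ae] g by simp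
  then have "integrable lborel H" by (simp add: integrable_completion)
  moreover have "(LINT x:\<Omega>|lebesgue. v x * \<zeta> x) = (LINT x|lborel. H x * \<zeta> x)"
    if \<zeta>: "continuous_on UNIV \<zeta>" "\<And>x. x \<notin> K \<Longrightarrow> \<zeta> x = 0" for \<zeta>
  proof -
    have \<zeta>b[measurable]: "\<zeta> \<in> borel_measurable borel" using \<zeta>(1) by (rule borel_measurable_continuous_onI)
    have \<zeta>m: "\<zeta> \<in> borel_measurable lebesgue" by (rule measurable_completion) simp
    have "(LINT x:\<Omega>|lebesgue. v x * \<zeta> x) = (LINT x|lebesgue. g x * \<zeta> x)"
      unfolding set_lebesgue_integral_def
      using \<zeta>(2) K(2) by (intro Bochner_Integration.integral_cong) (auto simp: g_def indicator_def)
    also have "\<dots> = (LINT x|lebesgue. H x * \<zeta> x)"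
      using ae by (intro integral_cong_AE borel_measurable_times borel_measurable_integrable[OF g] Hm \<zeta>m) auto
    also have "\<dots> = (LINT x|lborel. H x * \<zeta> x)"
      by (rule integral_completion) measurable
    finally show ?thesis .
  qed
  ultimately show ?thesis using that by blast
qed

lemma set_integrable_locally:
  fixes v \<zeta> :: "'a::euclidean_space \<Rightarrow> real"
  assumes v: "locally_integrable_on \<Omega> v" and K: "compact K" "K \<subseteq> \<Omega>"
    and \<zeta>: "continuous_on UNIV \<zeta>" "\<And>x. x \<notin> K \<Longrightarrow> \<zeta> x = 0"
  shows "set_integrable lebesgue \<Omega> (\<lambda>x. v x * \<zeta> x)"
proof -
  have g: "integrable lebesgue (\<lambda>x. indicator K x * v x)"
    using v K unfolding locally_integrable_on_def set_integrable_def by simp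
  obtain R where R: "\<And>x. x \<in> K \<Longrightarrow> norm x < R"
    using compact_imp_bounded[OF K(1)] unfolding bounded_pos_less by blast
  obtain B where B: "\<And>x. \<bar>\<zeta> x\<bar> \<le> B"
    using bounded_continuous_bounded_support[OF \<zeta>(1), of R] R \<zeta>(2) by (metis not_le)
  have "\<zeta> \<in> borel_measurable lborel" using \<zeta>(1) by (simp add: borel_measurable_continuous_onI)
  then have \<zeta>m: "\<zeta> \<in> borel_measurable lebesgue" by (rule measurable_completion)
  have "integrable lebesgue (\<lambda>x. B * (indicator K x * v x))" using g by simp
  then have "integrable lebesgue (\<lambda>x. (indicator K x * v x) * \<zeta> x)"
  proof (rule Bochner_Integration.integrable_bound)
    show "(\<lambda>x. (indicator K x * v x) * \<zeta> x) \<in> borel_measurable lebesgue"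
      by (intro borel_measurable_times borel_measurable_integrable[OF g] \<zeta>m)
    have "\<bar>\<zeta> x\<bar> \<le> \<bar>B\<bar>" for x using B[of x] by linarith
    then show "AE x in lebesgue. norm (indicator K x * v x * \<zeta> x) \<le> norm (B * (indicator K x * v x))"
      by (intro AE_I2) (auto simp: abs_mult mult.commute[of _ "\<bar>\<zeta> _\<bar>"] intro!: mult_right_mono)
  qed
  also have "(\<lambda>x. (indicator K x * v x) * \<zeta> x) = (\<lambda>x. indicator \<Omega> x *\<^sub>R (v x * \<zeta> x))"
    using \<zeta>(2) K(2) by (auto simp: fun_eq_iff indicator_def)
  finally show ?thesis unfolding set_integrable_def .
qed

text \<open>Testing the weak derivative with \<open>\<eta> (x - y)\<close>, for \<open>x\<close> in
  the support of \<open>\<psi>\<close>, says exactly that differentiating the kernel against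
  \<open>U\<close> equals mollifying \<open>v\<close>. That is the hypothesis of
  \<open>weak_chain_rule\<close>.\<close>

lemma weak_partial_chain_rule:
  fixes U \<psi> u v :: "'a::euclidean_space \<Rightarrow> real" and A a :: "real \<Rightarrow> real"
  assumes \<Omega>: "open \<Omega>" and U: "continuous_on UNIV U" and UC: "\<And>x. \<bar>U x\<bar> \<le> C"
    and uU: "\<And>x. x \<in> \<Omega> \<Longrightarrow> u x = U x"
    and v: "has_weak_partial_derivative \<Omega> b u v" and b: "b \<in> Basis"
    and A: "\<And>s. (A has_real_derivative a s) (at s)" and a: "continuous_on UNIV a"
    and \<psi>: "Ck 1 \<psi>" and K: "compact K" "K \<subseteq> \<Omega>" and \<psi>K: "\<And>x. x \<notin> K \<Longrightarrow> \<psi> x = 0"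
  shows "(LINT x|lborel. A (U x) * partial b \<psi> x) = - (LINT x:\<Omega>|lebesgue. v x * (a (U x) * \<psi> x))"
proof -
  obtain d where d: "d > 0" "(\<Union>x\<in>K. cball x d) \<subseteq> \<Omega>"
    using compact_subset_open_imp_cball_epsilon_subset[OF K(1) \<Omega> K(2)] by blast
  \<comment> \<open>The closed \<open>d\<close>-neighbourhood of \<open>K\<close> is compact in
    \<open>\<Omega>\<close> and contains the supports of all kernels centred in \<open>K\<close>, so
    a single \<open>H\<close> serves for every \<open>\<delta> \<le> d\<close>.\<close>
  define K' where "K' = {x + y | x y. x \<in> K \<and> y \<in> cball (0::'a) d}"
  have K': "compact K'" unfolding K'_def using K(1) by (intro compact_sums) auto
  have in_K': "y \<in> K'" if "x \<in> K" "norm (y - x) \<le> d" for x y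
  proof -
    have "y = x + (y - x)" "y - x \<in> cball 0 d" using that by auto
    then show ?thesis using that(1) unfolding K'_def by blast
  qed
  have "K' \<subseteq> \<Omega>"
  proof
    fix z assume "z \<in> K'"
    then obtain x y where xy: "z = x + y" "x \<in> K" "norm y \<le> d" unfolding K'_def by auto
    then have "z \<in> cball x d" by (simp add: dist_norm)
    then show "z \<in> \<Omega>" using d(2) xy(2) by blast
  qed
  have li: "locally_integrable_on \<Omega> v" using v unfolding has_weak_partial_derivative_def by blast
  obtain H where H: "integrable lborel H"
    "\<And>\<zeta>. continuous_on UNIV \<zeta> \<Longrightarrow> (\<And>x. x \<notin> K' \<Longrightarrow> \<zeta> x = 0) \<Longrightarrow>
      (LINT x:\<Omega>|lebesgue. v x * \<zeta> x) = (LINT x|lborel. H x * \<zeta> x)"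
    using locally_integrable_pairing[OF li K' \<open>K' \<subseteq> \<Omega>\<close>] by blast
  have "(LINT x|lborel. A (U x) * partial b \<psi> x) = - (LINT x|lborel. H x * (a (U x) * \<psi> x))"
  proof (rule weak_chain_rule[OF U UC A a b \<psi> K(1) \<psi>K H(1) d(1)])
    fix \<delta> x and \<eta> :: "'a \<Rightarrow> real" assume \<eta>: "mollifier \<delta> \<eta>" and \<delta>: "0 < \<delta>" "\<delta> \<le> d" and x: "x \<in> K"
    have diff: "\<forall>x. \<eta> differentiable (at x)" and contp: "continuous_on UNIV (partial b \<eta>)"
      using mollifierD(1)[OF \<eta>, of 1] b by auto
    have "cball x \<delta> \<subseteq> \<Omega>" using d(2) x subset_cball[OF \<delta>(2), of x] by blast
    then have "(LINT y:\<Omega>|lebesgue. u y * partial b (\<lambda>y. \<eta> (x - y)) y)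
        = - (LINT y:\<Omega>|lebesgue. v y * \<eta> (x - y))"
      using v mollifier_test_function[OF \<eta>] unfolding has_weak_partial_derivative_def by blast
    then have 1: "(LINT y:\<Omega>|lebesgue. u y * - partial b \<eta> (x - y))
        = - (LINT y:\<Omega>|lebesgue. v y * \<eta> (x - y))"
      by (simp add: partial_reflect(1)[OF diff])
    have 2: "(LINT y:\<Omega>|lebesgue. v y * \<eta> (x - y)) = convolve \<eta> H x"
      unfolding convolve_def
    proof (rule H(2))
      show "continuous_on UNIV (\<lambda>y. \<eta> (x - y))"
        by (intro continuous_on_compose2[OF mollifierD(5)[OF \<eta>]] continuous_intros) auto
      show "\<eta> (x - y) = 0" if "y \<notin> K'" for y
      proof (rule mollifierD(4)[OF \<eta>])
        have "d < norm (y - x)" using that in_K'[OF x, of y] by linarith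
        then show "\<delta> \<le> norm (x - y)" using \<delta>(2) by (simp add: norm_minus_commute)
      qed
    qed
    \<comment> \<open>Off \<open>\<Omega>\<close> the kernel derivative is zero, and inside
      \<open>u\<close> agrees with \<open>U\<close>, so the integral over \<open>\<Omega>\<close> is
      a convolution over the whole space.\<close>
    have "(\<lambda>y. indicator \<Omega> y *\<^sub>R (u y * - partial b \<eta> (x - y))) = (\<lambda>y. - (U y * partial b \<eta> (x - y)))"
    proof
      fix y
      show "indicator \<Omega> y *\<^sub>R (u y * - partial b \<eta> (x - y)) = - (U y * partial b \<eta> (x - y))"
      proof (cases "y \<in> \<Omega>")
        case False
        then have "y \<notin> cball x \<delta>" using \<open>cball x \<delta> \<subseteq> \<Omega>\<close> by blast
        then have "norm (x - y) > \<delta>" by (simp add: dist_norm)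
        have "partial b \<eta> (x - y) = 0"
        proof (rule partial_zero_norm[where \<phi> = \<eta>])
          show "\<eta> z = 0" if "\<delta> \<le> norm z" for z using that by (rule mollifierD(4)[OF \<eta>])
        qed fact
        then show ?thesis by simp
      qed (simp add: uU)
    qed
    then have "(LINT y:\<Omega>|lebesgue. u y * - partial b \<eta> (x - y)) = (LINT y|lebesgue. - (U y * partial b \<eta> (x - y)))"
      unfolding set_lebesgue_integral_def by simp
    also have "\<dots> = (LINT y|lborel. - (U y * partial b \<eta> (x - y)))"
    proof (rule integral_completion)
      have [measurable]: "partial b \<eta> \<in> borel_measurable borel" "U \<in> borel_measurable borel"
        using contp U by (auto intro: borel_measurable_continuous_onI)
      show "(\<lambda>y. - (U y * partial b \<eta> (x - y))) \<in> borel_measurable lborel" by measurable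
    qed
    also have "\<dots> = - convolve (partial b \<eta>) U x" unfolding convolve_def by simp
    finally show "convolve (partial b \<eta>) U x = convolve \<eta> H x" using 1 2 by simp
  qed
  also have "(LINT x|lborel. H x * (a (U x) * \<psi> x)) = (LINT x:\<Omega>|lebesgue. v x * (a (U x) * \<psi> x))"
  proof (rule H(2)[symmetric])
    show "continuous_on UNIV (\<lambda>x. a (U x) * \<psi> x)"
      by (intro continuous_intros continuous_on_compose2[OF a U] Ck_continuous[OF \<psi>]) auto
    show "a (U x) * \<psi> x = 0" if "x \<notin> K'" for x
      using \<psi>K[of x] in_K'[of x x] that d(1) by auto
  qed
  finally show ?thesis .
qed

text \<open>In distributional terms the Laplacian of \<open>A (u)\<close> is \<open>- f\<close>. The
  chain rule tested with \<open>partial b \<phi>\<close> and summed over \<open>b\<close> produces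
  the flux \<open>a (u) \<nabla>u\<close> paired with the gradient of \<open>\<phi>\<close>, and the
  weak divergence finishes.\<close>

lemma neumann_solution_very_weak:
  fixes U u f :: "'a::euclidean_space \<Rightarrow> real"
  assumes \<Omega>: "open \<Omega>" and U: "continuous_on UNIV U" and UC: "\<And>x. \<bar>U x\<bar> \<le> C"
    and uU: "\<And>x. x \<in> \<Omega> \<Longrightarrow> u x = U x"
    and A: "\<And>s. (A has_real_derivative a s) (at s)" and a: "continuous_on UNIV a"
    and sol: "neumann_solution \<Omega> a f j u" and \<phi>: "test_function \<Omega> \<phi>"
  shows "(LINT x|lborel. A (U x) * laplacian \<phi> x) = (LINT x:\<Omega>|lebesgue. - f x * \<phi> x)"
    and "integrable lborel (\<lambda>x. A (U x) * laplacian \<phi> x)"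
proof -
  obtain G where G: "\<And>b. b \<in> Basis \<Longrightarrow> has_weak_partial_derivative \<Omega> b u (\<lambda>x. G x \<bullet> b)"
    and div: "has_weak_divergence \<Omega> (\<lambda>x. a (u x) *\<^sub>R G x) (\<lambda>x. - f x)"
    using sol unfolding neumann_solution_def has_weak_gradient_def by blast
  define K where "K = closure {x. \<phi> x \<noteq> 0}"
  have K: "compact K" "K \<subseteq> \<Omega>" and Ck: "\<And>k. Ck k \<phi>"
    using \<phi> unfolding test_function_def K_def by auto
  have \<phi>K: "\<phi> x = 0" if "x \<notin> K" for x using that closure_subset[of "{x. \<phi> x \<noteq> 0}"] by (auto simp: K_def)
  have pK: "partial b \<phi> x = 0" if "x \<notin> K" for x b
    using that \<phi>K compact_imp_closed[OF K(1)] by (intro partial_zero_outside[of "- K"]) auto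
  have ppK: "partial b (partial b \<phi>) x = 0" if "x \<notin> K" for x b
    by (rule partial_zero_outside[of "- K"]) (use that pK compact_imp_closed[OF K(1)] in auto)
  have C1: "Ck 1 (partial b \<phi>)" if "b \<in> Basis" for b using Ck[of 2] that by (simp add: numeral_2_eq_2)
  have contA: "continuous_on UNIV A"
    using A by (meson DERIV_isCont continuous_at_imp_continuous_on)
  obtain R where R: "\<And>x. x \<in> K \<Longrightarrow> norm x < R"
    using compact_imp_bounded[OF K(1)] unfolding bounded_pos_less by blast
  have int: "integrable lborel (\<lambda>x. A (U x) * partial b (partial b \<phi>) x)" if b: "b \<in> Basis" for b
  proof (rule integrable_continuous_bounded_support[of _ R])
    have "continuous_on UNIV (partial b (partial b \<phi>))" using C1[OF b] b by simp
    then show "continuous_on UNIV (\<lambda>x. A (U x) * partial b (partial b \<phi>) x)"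
      by (intro continuous_intros continuous_on_compose2[OF contA U]) auto
    show "A (U x) * partial b (partial b \<phi>) x = 0" if "R \<le> norm x" for x
      using ppK[of x b] R[of x] that by fastforce
  qed
  have lap: "(\<lambda>x. A (U x) * laplacian \<phi> x) = (\<lambda>x. \<Sum>b\<in>Basis. A (U x) * partial b (partial b \<phi>) x)"
    by (simp add: laplacian_def sum_distrib_left)
  show "integrable lborel (\<lambda>x. A (U x) * laplacian \<phi> x)"
    unfolding lap using int by (rule Bochner_Integration.integrable_sum)
  have si: "set_integrable lebesgue \<Omega> (\<lambda>x. (G x \<bullet> b) * (a (U x) * partial b \<phi> x))" if b: "b \<in> Basis" for b
  proof (rule set_integrable_locally[OF _ K])
    show "locally_integrable_on \<Omega> (\<lambda>x. G x \<bullet> b)" using G[OF b] unfolding has_weak_partial_derivative_def by blast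
    show "continuous_on UNIV (\<lambda>x. a (U x) * partial b \<phi> x)"
      by (intro continuous_intros continuous_on_compose2[OF a U] Ck_continuous[OF C1[OF b]]) auto
  qed (simp add: pK)
  have "(LINT x|lborel. A (U x) * laplacian \<phi> x)
      = (\<Sum>b\<in>Basis. LINT x|lborel. A (U x) * partial b (partial b \<phi>) x)"
    unfolding lap by (rule Bochner_Integration.integral_sum) (rule int)
  also have "\<dots> = (\<Sum>b\<in>Basis. - (LINT x:\<Omega>|lebesgue. (G x \<bullet> b) * (a (U x) * partial b \<phi> x)))"
    by (intro sum.cong refl weak_partial_chain_rule[OF \<Omega> U UC uU G _ A a C1 K] pK)
  also have "\<dots> = - (\<Sum>b\<in>Basis. LINT x:\<Omega>|lebesgue. (G x \<bullet> b) * (a (U x) * partial b \<phi> x))"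
    by (rule sum_negf)
  also have "(\<Sum>b\<in>Basis. LINT x:\<Omega>|lebesgue. (G x \<bullet> b) * (a (U x) * partial b \<phi> x))
      = (LINT x|lebesgue. (\<Sum>b\<in>Basis. indicator \<Omega> x *\<^sub>R ((G x \<bullet> b) * (a (U x) * partial b \<phi> x))))"
    unfolding set_lebesgue_integral_def
    by (rule Bochner_Integration.integral_sum[symmetric]) (use si in \<open>simp add: set_integrable_def\<close>)
  also have "\<dots> = (LINT x:\<Omega>|lebesgue. frechet_derivative \<phi> (at x) (a (u x) *\<^sub>R G x))"
    unfolding set_lebesgue_integral_def
  proof (intro Bochner_Integration.integral_cong refl)
    fix x
    have "linear (frechet_derivative \<phi> (at x))"
      using Ck[of 1] by (intro linear_frechet_derivative) simp
    then have "frechet_derivative \<phi> (at x) (\<Sum>b\<in>Basis. ((a (u x) *\<^sub>R G x) \<bullet> b) *\<^sub>R b)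
        = (\<Sum>b\<in>Basis. ((a (u x) *\<^sub>R G x) \<bullet> b) * partial b \<phi> x)"
      by (simp add: linear_sum linear_cmul)
    then have "frechet_derivative \<phi> (at x) (a (u x) *\<^sub>R G x)
        = (\<Sum>b\<in>Basis. ((a (u x) *\<^sub>R G x) \<bullet> b) * partial b \<phi> x)"
      by (simp only: euclidean_representation)
    then show "(\<Sum>b\<in>Basis. indicator \<Omega> x *\<^sub>R ((G x \<bullet> b) * (a (U x) * partial b \<phi> x)))
        = indicator \<Omega> x *\<^sub>R frechet_derivative \<phi> (at x) (a (u x) *\<^sub>R G x)"
      by (cases "x \<in> \<Omega>") (simp_all add: uU mult_ac)
  qed
  also have "- \<dots> = (LINT x:\<Omega>|lebesgue. - f x * \<phi> x)"
    using div \<phi> unfolding has_weak_divergence_def by fastforce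
  finally show "(LINT x|lborel. A (U x) * laplacian \<phi> x) = (LINT x:\<Omega>|lebesgue. - f x * \<phi> x)" .
qed

text \<open>The interior ball keeps the inward normal ray in \<open>\<Omega>\<close> for small
  \<open>t\<close>, where \<open>u\<close> and \<open>U\<close> agree; the one-variable chain rule
  from the right then applies along the ray.\<close>

lemma outward_normal_derivative_chain:
  assumes \<Omega>: "C11_boundary \<Omega>" and x: "x \<in> frontier \<Omega>"
    and uU: "\<And>x. x \<in> closure \<Omega> \<Longrightarrow> u x = U x"
    and A: "(A has_real_derivative a (U x)) (at (U x))"
    and D: "has_outward_normal_derivative \<Omega> u x D"
  shows "has_outward_normal_derivative \<Omega> (\<lambda>x. A (U x)) x (a (U x) * D)"
proof -
  define \<nu> where "\<nu> = outward_normal \<Omega> x"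
  obtain R where R: "R > 0" "ball (x - R *\<^sub>R \<nu>) R \<subseteq> \<Omega>" "norm \<nu> = 1"
    using interior_ball[OF \<Omega> x] unfolding \<nu>_def by blast
  have "x \<in> closure \<Omega>" using x by (simp add: frontier_def)
  then have "u x = U x" by (rule uU)
  \<comment> \<open>The quotient in the definition runs inward, so it is minus the right difference
    quotient of \<open>U (x - t *\<^sub>R \<nu>)\<close> at \<open>t = 0\<close>.\<close>
  have "\<forall>\<^sub>F t in at_right 0. (u x - u (x - t *\<^sub>R \<nu>)) / t = - ((U (x - t *\<^sub>R \<nu>) - U (x - 0 *\<^sub>R \<nu>)) / (t - 0))"
    using inward_points[OF R(2,1,3)]
  proof eventually_elim
    fix t assume "x - t *\<^sub>R \<nu> \<in> \<Omega>"
    then have "u (x - t *\<^sub>R \<nu>) = U (x - t *\<^sub>R \<nu>)" using uU closure_subset by blast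
    then show "(u x - u (x - t *\<^sub>R \<nu>)) / t = - ((U (x - t *\<^sub>R \<nu>) - U (x - 0 *\<^sub>R \<nu>)) / (t - 0))"
      using \<open>u x = U x\<close> by (simp add: minus_divide_left)
  qed
  from Lim_transform_eventually[OF D[unfolded has_outward_normal_derivative_def, folded \<nu>_def] this]
  have "((\<lambda>t. (U (x - t *\<^sub>R \<nu>) - U (x - 0 *\<^sub>R \<nu>)) / (t - 0)) \<longlongrightarrow> - D) (at_right 0)"
    by (subst (asm) tendsto_minus_cancel_left[symmetric]) simp
  then have "((\<lambda>t. U (x - t *\<^sub>R \<nu>)) has_real_derivative - D) (at_right 0)"
    unfolding has_field_derivative_iff .
  then have "((\<lambda>t. A (U (x - t *\<^sub>R \<nu>))) has_real_derivative a (U x) * - D) (at_right 0)"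
    using A by (intro DERIV_chain2) simp_all
  then have "((\<lambda>t. (A (U (x - t *\<^sub>R \<nu>)) - A (U x)) / t) \<longlongrightarrow> a (U x) * - D) (at_right 0)"
    unfolding has_field_derivative_iff by simp
  from tendsto_minus[OF this] show ?thesis
    unfolding has_outward_normal_derivative_def \<nu>_def[symmetric] by (simp add: minus_divide_left)
qed

text \<open>Tietze's theorem supplies the bounded continuous function on the whole space that
  convolution and the maximum principle work with.\<close>

lemma continuous_extension_bounded:
  fixes u :: "'a::euclidean_space \<Rightarrow> real"
  assumes "compact S" "continuous_on S u"
  obtains U C where "continuous_on UNIV U" "\<And>x. x \<in> S \<Longrightarrow> U x = u x" "\<And>x. \<bar>U x\<bar> \<le> C"
proof -
  have "compact (u ` S)" by (intro compact_continuous_image assms)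
  then obtain C where C: "C > 0" "\<And>x. x \<in> S \<Longrightarrow> norm (u x) \<le> C"
    using compact_imp_bounded[of "u ` S"] by (auto simp: bounded_pos)
  moreover have "closedin (top_of_set UNIV) S" using compact_imp_closed[OF assms(1)] by simp
  ultimately obtain U where "continuous_on UNIV U" "\<And>x. x \<in> S \<Longrightarrow> U x = u x" "\<And>x. norm (U x) \<le> C"
    using Tietze[OF assms(2)] by (metis UNIV_I less_imp_le)
  then show ?thesis using that[of U C] by simp
qed

lemma antiderivative_exists:
  fixes a :: "real \<Rightarrow> real"
  assumes "continuous_on UNIV a"
  obtains A where "\<And>s. (A has_real_derivative a s) (at s)"
proof -
  have "\<exists>A. \<forall>x. -\<infinity> < ereal x \<longrightarrow> ereal x < \<infinity> \<longrightarrow> (A has_vector_derivative a x) (at x)"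
    using assms by (intro einterval_antiderivative) (auto simp: continuous_on_eq_continuous_at)
  then show ?thesis using that by (auto simp: has_real_derivative_iff_has_vector_derivative)
qed

theorem theorem2:
  fixes \<Omega> :: "(real ^ 'n) set"
    and \<gamma> :: "real \<Rightarrow> real ^ 'n"
    and f j g u u' :: "real ^ 'n \<Rightarrow> real"
    and a a' :: "real \<Rightarrow> real"
    and a_lo a_hi C\<^sub>1 :: real
  assumes "CARD('n) \<in> {2, 3}"
    and "bounded_domain \<Omega>" and "C11_boundary \<Omega>"
    and "C1_curve \<gamma>" and "\<gamma> ` {0..1} \<subseteq> frontier \<Omega>"
    and "in_Lp \<Omega> \<infinity> f" and "in_W1inf_boundary \<Omega> j"
    and "(LINT x:\<Omega>|lebesgue. f x) + surface_integral (frontier \<Omega>) j = 0"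
    and "0 < a_lo" and "a_lo \<le> a_hi"
    and "a \<in> admissible a_lo a_hi C\<^sub>1" and "a' \<in> admissible a_lo a_hi C\<^sub>1"
    and "neumann_solution \<Omega> a f j u" and "neumann_solution \<Omega> a' f j u'"
    and "\<forall>x \<in> \<gamma> ` {0..1}. u x = g x \<and> u' x = g x"
  shows "\<forall>s \<in> interior ((\<lambda>r. g (\<gamma> r)) ` {0..1}). a s = a' s"
proof
  fix s assume s: "s \<in> interior ((\<lambda>r. g (\<gamma> r)) ` {0..1})"
  have \<Omega>: "open \<Omega>" "compact (closure \<Omega>)"
    using \<open>bounded_domain \<Omega>\<close> by (auto simp: bounded_domain_def compact_closure)
  have a: "continuous_on UNIV a" and a': "continuous_on UNIV a'"
    using \<open>a \<in> _\<close> \<open>a' \<in> _\<close> unfolding admissible_def by blast+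
  note sol = \<open>neumann_solution \<Omega> a f j u\<close> and sol' = \<open>neumann_solution \<Omega> a' f j u'\<close>
  obtain A where A: "\<And>s. (A has_real_derivative a s) (at s)" using antiderivative_exists[OF a] by blast
  obtain A' where A': "\<And>s. (A' has_real_derivative a' s) (at s)" using antiderivative_exists[OF a'] by blast
  obtain U C where U: "continuous_on UNIV U" "\<And>x. x \<in> closure \<Omega> \<Longrightarrow> U x = u x" "\<And>x. \<bar>U x\<bar> \<le> C"
    using continuous_extension_bounded[OF \<Omega>(2), of u] sol unfolding neumann_solution_def by blast
  obtain U' C' where U': "continuous_on UNIV U'" "\<And>x. x \<in> closure \<Omega> \<Longrightarrow> U' x = u' x" "\<And>x. \<bar>U' x\<bar> \<le> C'"
    using continuous_extension_bounded[OF \<Omega>(2), of u'] sol' unfolding neumann_solution_def by blast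
  have contA: "continuous_on UNIV A" "continuous_on UNIV A'"
    using A A' by (meson DERIV_isCont continuous_at_imp_continuous_on)+
  obtain B where B: "\<And>s. \<bar>s\<bar> \<le> C \<Longrightarrow> \<bar>A s\<bar> \<le> B"
    using continuous_bounded_on_interval[OF contA(1)] by blast
  obtain B' where B': "\<And>s. \<bar>s\<bar> \<le> C' \<Longrightarrow> \<bar>A' s\<bar> \<le> B'"
    using continuous_bounded_on_interval[OF contA(2)] by blast
  define W where "W x = A (U x) - A' (U' x)" for x
  have in_cl: "x \<in> closure \<Omega>" if "x \<in> \<Omega>" for x using that closure_subset by blast
  have "\<exists>c. \<forall>x\<in>closure \<Omega>. W x = c"
  proof (rule homogeneous_Neumann_constant[OF _ _ _ \<open>bounded_domain \<Omega>\<close> \<open>C11_boundary \<Omega>\<close>])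
    show "continuous_on UNIV W"
      unfolding W_def
      by (intro continuous_intros continuous_on_compose2[OF contA(1) U(1)] continuous_on_compose2[OF contA(2) U'(1)]) auto
    show "\<bar>W x\<bar> \<le> B + B'" for x
      using B[OF U(3)[of x]] B'[OF U'(3)[of x]] by (simp add: W_def)
    show "weakly_harmonic \<Omega> W"
      unfolding weakly_harmonic_def
    proof (intro allI impI)
      fix \<phi> :: "real ^ 'n \<Rightarrow> real" assume \<phi>: "test_function \<Omega> \<phi>"
      have uU: "u x = U x" "u' x = U' x" if "x \<in> \<Omega>" for x using in_cl[OF that] U(2) U'(2) by simp_all
      note w = neumann_solution_very_weak[OF \<Omega>(1) U(1,3) uU(1) A a sol \<phi>]
      note w' = neumann_solution_very_weak[OF \<Omega>(1) U'(1,3) uU(2) A' a' sol' \<phi>]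
      have "(LINT x|lborel. W x * laplacian \<phi> x)
          = (LINT x|lborel. A (U x) * laplacian \<phi> x - A' (U' x) * laplacian \<phi> x)"
        by (simp add: W_def left_diff_distrib)
      \<comment> \<open>Both integrals equal the same pairing of \<open>- f\<close> with
        \<open>\<phi>\<close>, so the common source cancels.\<close>
      also have "\<dots> = 0"
        using w w' by simp
      finally show "(LINT x|lborel. W x * laplacian \<phi> x) = 0" .
    qed
    show "has_outward_normal_derivative \<Omega> W x 0" if x: "x \<in> frontier \<Omega>" for x
    proof -
      have "x \<in> closure \<Omega>" using x by (simp add: frontier_def)
      obtain D where D: "has_outward_normal_derivative \<Omega> u x D" "a (u x) * D = j x"
        using sol x unfolding neumann_solution_def by blast
      obtain D' where D': "has_outward_normal_derivative \<Omega> u' x D'" "a' (u' x) * D' = j x"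
        using sol' x unfolding neumann_solution_def by blast
      \<comment> \<open>The chain rule turns the normal derivative of \<open>A (u)\<close> into the
        prescribed flux \<open>a (u) * D = j\<close>; the same value arises for \<open>u'\<close>,
        so the difference has normal derivative 0.\<close>
      have "has_outward_normal_derivative \<Omega> (\<lambda>x. A (U x)) x (j x)"
        using outward_normal_derivative_chain[where A = A and a = a and U = U, OF \<open>C11_boundary \<Omega>\<close> x U(2)[symmetric] A D(1)]
          D(2) U(2)[OF \<open>x \<in> closure \<Omega>\<close>] by simp
      moreover have "has_outward_normal_derivative \<Omega> (\<lambda>x. A' (U' x)) x (j x)"
        using outward_normal_derivative_chain[where A = A' and a = a' and U = U', OF \<open>C11_boundary \<Omega>\<close> x U'(2)[symmetric] A' D'(1)]
          D'(2) U'(2)[OF \<open>x \<in> closure \<Omega>\<close>] by simp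
      ultimately show ?thesis
        unfolding has_outward_normal_derivative_def W_def
        by (rule tendsto_eq_rhs[OF Lim_transform_eventually[OF tendsto_diff]])
           (auto simp: diff_divide_distrib)
    qed
  qed
  then obtain c where c: "\<And>x. x \<in> closure \<Omega> \<Longrightarrow> W x = c" by blast
  \<comment> \<open>On the curve both solutions equal \<open>g\<close>, so the constancy of
    \<open>W\<close> becomes a statement about one real variable.\<close>
  have const: "A t - A' t = c" if "t \<in> (\<lambda>r. g (\<gamma> r)) ` {0..1}" for t
  proof -
    obtain x where x: "x \<in> \<gamma> ` {0..1}" "t = g x" using \<open>t \<in> _\<close> by auto
    then have "x \<in> closure \<Omega>" using \<open>\<gamma> ` {0..1} \<subseteq> frontier \<Omega>\<close> by (auto simp: frontier_def)
    then show ?thesis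
      using c[of x] U(2)[of x] U'(2)[of x] x assms(15) by (simp add: W_def)
  qed
  have "((\<lambda>t. A t - A' t) has_real_derivative a s - a' s) (at s)"
    by (intro DERIV_diff A A')
  \<comment> \<open>Here \<open>s\<close> being an interior value matters: \<open>A - A'\<close> is
    constant on a whole neighbourhood of \<open>s\<close>, so its two-sided derivative there is
    0.\<close>
  moreover have "((\<lambda>t. A t - A' t) has_real_derivative 0) (at s)"
  proof (rule has_field_derivative_transform_within_open[OF DERIV_const[of c] open_interior s])
    fix t assume "t \<in> interior ((\<lambda>r. g (\<gamma> r)) ` {0..1})"
    then have "t \<in> (\<lambda>r. g (\<gamma> r)) ` {0..1}" using interior_subset by blast
    from const[OF this] show "c = A t - A' t" by (rule sym)
  qed
  ultimately have "a s - a' s = 0" by (rule DERIV_unique)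
  then show "a s = a' s" by simp
qed

end
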